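(* Let $K$ be a commutative ring, let $d,k\ge 0$ be integers, and let $V$ be a free $K$-module of rank $d+1$ with basis $x_0,\ldots,x_d$, equipped with a symmetric bilinear form $\langle\cdot,\cdot\rangle:V\times V\to K$ with Gram matrix $G=(\langle x_i,x_j\rangle)_{0\le i,j\le d}$. Let $\langle\langle\cdot,\cdot\rangle\rangle$ be the induced symmetric bilinear form on $\operatorname{Sym}^kV$ (defined in the context), and let $\mathbb{G}=\big(\langle\langle x^\alpha,x^\beta\rangle\rangle\big)_{|\alpha|=|\beta|=k}$ be its Gram matrix with respect to the monomial basis. Then $$\det(\mathbb{G})=\det(G)^{\binom{d+k}{d+1}}\,\theta_{d,k},$$ where $\theta_{d,k}$ is the (image in $K$ of the) integer $$\theta_{d,k}=\prod_{i=1}^k i^{\,d\binom{k-i+d}{d}}\;\prod_{\substack{1\le i\le 2k+d-1\\ i\text{ odd}}} i^{\binom{k-i+d}{d}}\quad\text{if }d\text{ is even},$$ $$\theta_{d,k}=\prod_{i=1}^k i^{\,d\binom{k-i+d}{d}}\;\prod_{i=1}^{k+\frac{d-1}{2}} i^{\binom{k-i+d}{d}-\binom{k-2i+d}{d}}\quad\text{if }d\text{ is odd}.$$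
   Context: Binomial coefficients: for an integer $n\ge 0$ and arbitrary (possibly negative) $z$, $\binom{z}{n}=\frac{z(z-1)\cdots(z-n+1)}{n!}$; in particular $\binom{-z}{n}=(-1)^n\binom{z+n-1}{n}$. Multi-indices $\alpha=(\alpha_0,\ldots,\alpha_d)$ have nonnegative integer entries, $|\alpha|=\sum_i\alpha_i$ and $x^\alpha=x_0^{\alpha_0}\cdots x_d^{\alpha_d}$. The symmetric power $\operatorname{Sym}^kV$ is identified with the homogeneous polynomials of degree $k$, $K[x_0,\ldots,x_d]_k$, with basis the monomials $x^\alpha$, $|\alpha|=k$. The induced form on $\operatorname{Sym}^kV$ is the symmetric bilinear form defined on the basis $\{x_{n_1}\cdots x_{n_k}\mid 0\le n_1\le\ldots\le n_k\le d\}$ by $$\langle\langle x_{n_1}\cdots x_{n_k},\,x_{n_{k+1}}\cdots x_{n_{2k}}\rangle\rangle=\sum_{\mathcal P}\ \prod_{\{i,j\}\in\mathcal P}\langle x_{n_i},x_{n_j}\rangle,$$ where the sum runs over all partitions $\mathcal P$ of $\{1,\ldots,2k\}$ into (unordered) pairs. *)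

theory Defs
  imports
    Complex_Main
    "HOL-Library.Poly_Mapping"
    "HOL-Library.Disjoint_Sets"
    "HOL-Library.FuncSet"
    "Jordan_Normal_Form.Determinant"
begin

definition symmetric_bilinear_form_on ::
  "('k::comm_ring_1 \<Rightarrow> 'v::ab_group_add \<Rightarrow> 'v) \<Rightarrow> 'v set \<Rightarrow> ('v \<Rightarrow> 'v \<Rightarrow> 'k) \<Rightarrow> bool"
where
  "symmetric_bilinear_form_on scale V B \<longleftrightarrow>
     (\<forall>u\<in>V. \<forall>v\<in>V. B u v = B v u) \<and>
     (\<forall>u\<in>V. \<forall>v\<in>V. \<forall>w\<in>V. B (u + v) w = B u w + B v w) \<and>
     (\<forall>c. \<forall>u\<in>V. \<forall>w\<in>V. B (scale c u) w = c * B u w)"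

definition gram_matrix :: "('a \<Rightarrow> 'a \<Rightarrow> 'k) \<Rightarrow> 'a list \<Rightarrow> 'k mat" where
  "gram_matrix B vs = mat (length vs) (length vs) (\<lambda>(i, j). B (vs ! i) (vs ! j))"

text \<open>
  Polynomials in \<open>x\<^sub>0, x\<^sub>1, \<dots>\<close> over \<open>'k\<close> are finitely supported functions from exponent
  vectors to coefficients. The symmetric power \<open>Sym\<^sup>k V\<close> is identified with the set of those
  polynomials whose support lies in \<open>multi_indices d k\<close>.
\<close>

definition multi_indices :: "nat \<Rightarrow> nat \<Rightarrow> (nat \<Rightarrow>\<^sub>0 nat) set" where
  "multi_indices d k =
     {\<alpha>. Poly_Mapping.keys \<alpha> \<subseteq> {..d} \<and> (\<Sum>i\<le>d. Poly_Mapping.lookup \<alpha> i) = k}"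

definition monomial :: "(nat \<Rightarrow>\<^sub>0 nat) \<Rightarrow> ((nat \<Rightarrow>\<^sub>0 nat) \<Rightarrow>\<^sub>0 'k::comm_ring_1)" where
  "monomial \<alpha> = Poly_Mapping.single \<alpha> 1"

text \<open>
  The weakly increasing word \<open>n\<^sub>1 \<le> \<dots> \<le> n\<^sub>k\<close> with
  \<open>x\<^sup>\<alpha> = x\<^bsub>n\<^sub>1\<^esub> \<cdots> x\<^bsub>n\<^sub>k\<^esub>\<close>.
\<close>

definition index_word :: "nat \<Rightarrow> (nat \<Rightarrow>\<^sub>0 nat) \<Rightarrow> nat list" where
  "index_word d \<alpha> = concat (map (\<lambda>i. replicate (Poly_Mapping.lookup \<alpha> i) i) [0..<d + 1])"

text \<open>
  The sum runs over all partitions of the positions of \<open>vs\<close> (counted from 0) into unordered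
  pairs. A block \<open>e = {i, j}\<close> contributes \<open>B (vs ! i) (vs ! j)\<close>; for symmetric \<open>B\<close> the order
  in which \<open>Min e\<close> and \<open>Max e\<close> are used is immaterial.
\<close>

definition pairing_sum :: "('v \<Rightarrow> 'v \<Rightarrow> 'k::comm_ring_1) \<Rightarrow> 'v list \<Rightarrow> 'k" where
  "pairing_sum B vs =
     (\<Sum>P | partition_on {..<length vs} P \<and> (\<forall>e\<in>P. card e = 2).
        \<Prod>e\<in>P. B (vs ! Min e) (vs ! Max e))"

text \<open>
  Bilinear extension to \<open>Sym\<^sup>k V\<close> of the values on pairs of monomials given in
  \<open>induced_form_monomial\<close> below.
\<close>

definition induced_form ::
  "('v \<Rightarrow> 'v \<Rightarrow> 'k::comm_ring_1) \<Rightarrow> (nat \<Rightarrow> 'v) \<Rightarrow> nat \<Rightarrow> nat \<Rightarrow>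
   ((nat \<Rightarrow>\<^sub>0 nat) \<Rightarrow>\<^sub>0 'k) \<Rightarrow> ((nat \<Rightarrow>\<^sub>0 nat) \<Rightarrow>\<^sub>0 'k) \<Rightarrow> 'k"
where
  "induced_form B x d k p q =
     (\<Sum>\<alpha>\<in>multi_indices d k. \<Sum>\<beta>\<in>multi_indices d k.
        Poly_Mapping.lookup p \<alpha> * Poly_Mapping.lookup q \<beta> *
        pairing_sum B (map x (index_word d \<alpha> @ index_word d \<beta>)))"

text \<open>
  The library's \<open>gchoose\<close> at type \<open>int\<close>, which its current sort constraint excludes. The
  division is exact: see \<open>of_int_int_choose\<close> below.
\<close>

definition int_choose :: "int \<Rightarrow> nat \<Rightarrow> int" (infix \<open>ichoose\<close> 64) where
  "z ichoose n = (\<Prod>i=0..<n. z - int i) div fact n"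

text \<open>
  The upper arguments of the binomial coefficients can be negative, but all exponents are
  nonnegative (\<open>theta_exponent_common\<close>, \<open>theta_exponent_even\<close> and \<open>theta_exponent_odd\<close>
  below), so \<open>nat\<close> does not truncate.
\<close>

definition theta :: "nat \<Rightarrow> nat \<Rightarrow> int" where
  "theta d k =
     (\<Prod>i=1..k. int i ^ nat (int d * ((int k - int i + int d) ichoose d))) *
     (if even d
      then \<Prod>i | 1 \<le> i \<and> i \<le> 2 * k + d - 1 \<and> odd i.
             int i ^ nat ((int k - int i + int d) ichoose d)
      else \<Prod>i=1..k + (d - 1) div 2.
             int i ^ nat (((int k - int i + int d) ichoose d) -
                          ((int k - 2 * int i + int d) ichoose d)))"

lemma finite_multi_indices: "finite (multi_indices d k)"
proof (rule finite_imageD)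
  let ?f = "\<lambda>\<alpha>. restrict (Poly_Mapping.lookup \<alpha>) {..d}"
  have "?f ` multi_indices d k \<subseteq> {..d} \<rightarrow>\<^sub>E {..k}"
  proof (clarsimp simp: multi_indices_def PiE_iff)
    fix \<alpha> :: "nat \<Rightarrow>\<^sub>0 nat" and i
    assume "i \<le> d"
    then show "Poly_Mapping.lookup \<alpha> i \<le> (\<Sum>i\<le>d. Poly_Mapping.lookup \<alpha> i)"
      by (intro member_le_sum) auto
  qed
  then show "finite (?f ` multi_indices d k)"
    by (rule finite_subset) (auto intro: finite_PiE)
  show "inj_on ?f (multi_indices d k)"
  proof (rule inj_onI)
    fix \<alpha> \<beta>
    assume a: "\<alpha> \<in> multi_indices d k" and b: "\<beta> \<in> multi_indices d k" and e: "?f \<alpha> = ?f \<beta>"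
    show "\<alpha> = \<beta>"
    proof (rule poly_mapping_eqI)
      fix i
      show "Poly_Mapping.lookup \<alpha> i = Poly_Mapping.lookup \<beta> i"
      proof (cases "i \<le> d")
        case True
        then show ?thesis using fun_cong[OF e, of i] by simp
      next
        case False
        then have "i \<notin> Poly_Mapping.keys \<alpha>" "i \<notin> Poly_Mapping.keys \<beta>"
          using a b by (auto simp: multi_indices_def)
        then show ?thesis by (simp add: in_keys_iff)
      qed
    qed
  qed
qed

lemma induced_form_monomial:
  assumes "\<alpha> \<in> multi_indices d k" "\<beta> \<in> multi_indices d k"
  shows "induced_form B x d k (monomial \<alpha>) (monomial \<beta>) =
         pairing_sum B (map x (index_word d \<alpha> @ index_word d \<beta>))"
proof -
  have "induced_form B x d k (monomial \<alpha>) (monomial \<beta>) =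
    (\<Sum>\<alpha>'\<in>multi_indices d k. if \<alpha>' = \<alpha> then
       (\<Sum>\<beta>'\<in>multi_indices d k. if \<beta>' = \<beta> then
          pairing_sum B (map x (index_word d \<alpha>' @ index_word d \<beta>')) else 0) else 0)"
    unfolding induced_form_def monomial_def lookup_single when_def
    by (intro sum.cong refl) (auto intro!: sum.cong)
  then show ?thesis
    using assms by (simp add: finite_multi_indices)
qed

lemma of_int_int_choose: "of_int (z ichoose n) = (of_int z gchoose n :: 'a::field_char_0)"
proof -
  have "fact n * (z ichoose n) = (\<Prod>i=0..<n. z - int i)"
    unfolding int_choose_def using gbinomial_int_mult_fact[of n z]
    by (simp add: gbinomial_prod_rev)
  then have "of_int (fact n * (z ichoose n)) = (of_int (\<Prod>i=0..<n. z - int i) :: 'a)"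
    by simp
  then have "fact n * of_int (z ichoose n) = (\<Prod>i=0..<n. of_int z - of_nat i :: 'a)"
    by simp
  then show ?thesis
    by (simp add: gbinomial_mult_fact [symmetric])
qed

lemma ichoose_nonneg: "0 \<le> z \<Longrightarrow> z ichoose n = int (nat z choose n)"
  using gbinomial_nneg[of z n] by (simp add: int_choose_def gbinomial_prod_rev)

lemma ichoose_negated_upper: "z ichoose n = (-1) ^ n * ((int n - z - 1) ichoose n)"
  using gbinomial_int_negated_upper[of z n] by (simp add: int_choose_def gbinomial_prod_rev)

lemma theta_exponent_common:
  assumes "i \<le> k"
  shows "0 \<le> int d * ((int k - int i + int d) ichoose d)"
  using assms by (simp add: ichoose_nonneg)

lemma theta_exponent_even:
  fixes z :: int
  assumes "even d"
  shows "0 \<le> z ichoose d"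
proof (cases "0 \<le> z")
  case True
  then show ?thesis by (simp add: ichoose_nonneg)
next
  case False
  then show ?thesis
    using assms by (simp add: ichoose_negated_upper[of z] ichoose_nonneg)
qed

lemma theta_exponent_odd:
  assumes "odd d" "1 \<le> i" "i \<le> k + (d - 1) div 2"
  shows "0 \<le> ((int k - int i + int d) ichoose d) - ((int k - 2 * int i + int d) ichoose d)"
proof -
  have pos: "0 \<le> int k - int i + int d"
    using assms by linarith
  show ?thesis
  proof (cases "0 \<le> int k - 2 * int i + int d")
    case True
    then have "nat (int k - 2 * int i + int d) choose d \<le> nat (int k - int i + int d) choose d"
      by (intro binomial_right_mono nat_mono) simp
    then show ?thesis
      using True pos by (simp add: ichoose_nonneg)
  next
    case False
    then have "((int k - 2 * int i + int d) ichoose d) \<le> 0"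
      using assms(1)
      by (simp add: ichoose_negated_upper[of "int k - 2 * int i + int d"] ichoose_nonneg)
    moreover have "0 \<le> (int k - int i + int d) ichoose d"
      using pos by (simp add: ichoose_nonneg)
    ultimately show ?thesis by linarith
  qed
qed

end

theory Submission
  imports Defs "Jordan_Normal_Form.Char_Poly"
begin

text \<open>
  A congruence \<open>G \<mapsto> A G A\<^sup>T\<close> with \<open>A\<close> lower triangular changes the induced Gram matrix by
  \<open>Sym\<^sup>k A\<close>, which is again triangular, so that its determinant is a power of \<open>det A\<close>. After
  perturbing \<open>G\<close> to \<open>s I + G\<close> over \<open>K[s]\<close> this reduces the formula to diagonal forms, and a
  scaling argument in the Leibniz expansion reduces those to \<open>G = I\<close> over the integers.

  For \<open>G = I\<close> the induced form is the Gaussian expectation \<open>E[p q]\<close>. Compared with the inner product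
  for which the monomials are orthogonal of square length \<open>a!\<close>, it acts on the quotient of
  \<open>r\<^bsup>2j\<^esup>K[x]\<^bsub>k-2j\<^esub>\<close> by \<open>r\<^bsup>2j+2\<^esup>K[x]\<^bsub>k-2j-2\<^esub>\<close> as the scalar
  \<open>\<Prod>\<^bsub>1\<le>i\<le>j\<^esub> (2k + d + 1 - 2i) / (2i)\<close>, where \<open>r\<^sup>2\<close> is the squared norm. Multiplying these scalars
  with the factorials gives \<open>\<theta>\<close>.
\<close>

section \<open>Sums over perfect matchings\<close>

text \<open>A denominator-free version diagonalizes \<open>G\<close> at the price of a power of
  these minors on both sides, and the perturbation serves only to make that power cancellable. The
  scalars have two sources. For homogeneous \<open>p\<close>,
  \<open>E[r^2 p] = (d + 1 + deg p) E[p]\<close>; stripping \<open>j\<close> factors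
  \<open>r^2\<close> from a product of total degree \<open>2k\<close> therefore releases the
  numerators \<open>2k + d + 1 - 2i\<close>, \<open>1 \<le> i \<le> j\<close>. The denominators
  \<open>2i\<close> multiply to \<open>2^j j!\<close>, the constant in
  \<open>j! 2^j E[x^a] = a! [x^a] r^(2j)\<close> for \<open>|a| = 2j\<close>. The numerators are odd
  exactly when \<open>d\<close> is even. In that case the denominators remove the even factors of
  the factorials and odd numbers remain; for odd \<open>d\<close> a 2 cancels in each scalar
  instead. This is the origin of the two shapes of \<open>theta\<close>.\<close>

definition pairings :: "'a set \<Rightarrow> 'a set set set" where
  "pairings A = {P. partition_on A P \<and> (\<forall>e\<in>P. card e = 2)}"

text \<open>Weights sit on unordered pairs, so relabelling and deleting points need no symmetry of a
  form. The \<open>Min\<close>/\<open>Max\<close> convention enters only in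
  \<open>pairing_sum_hafnian\<close>.\<close>

definition hafnian :: "('a set \<Rightarrow> 'k::comm_ring_1) \<Rightarrow> 'a set \<Rightarrow> 'k" where
  "hafnian w A = (\<Sum>P\<in>pairings A. \<Prod>e\<in>P. w e)"

lemma pairings_empty [simp]: "pairings {} = {{}}"
  by (auto simp: pairings_def partition_on_empty)

lemma hafnian_empty [simp]: "hafnian w {} = 1"
  by (simp add: hafnian_def)

lemma finite_pairings: "finite A \<Longrightarrow> finite (pairings A)"
  unfolding pairings_def by (rule finite_subset[OF _ finitely_many_partition_on]) auto

lemma pairings_subset: "P \<in> pairings A \<Longrightarrow> e \<in> P \<Longrightarrow> e \<subseteq> A \<and> card e = 2"
  by (auto simp: pairings_def partition_on_def)

lemma hafnian_cong:
  assumes "\<And>e. e \<subseteq> A \<Longrightarrow> card e = 2 \<Longrightarrow> w e = w' e"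
  shows "hafnian w A = hafnian w' A"
  unfolding hafnian_def using assms pairings_subset by (intro sum.cong prod.cong refl) blast

lemma image_mem_pairings:
  assumes "inj_on f A" "P \<in> pairings A"
  shows "(`) f ` P \<in> pairings (f ` A)"
proof -
  have P: "partition_on A P" "\<And>e. e \<in> P \<Longrightarrow> card e = 2 \<and> e \<subseteq> A"
    using assms(2) pairings_subset by (auto simp: pairings_def)
  have "{} \<notin> (`) f ` P"
    using P(1) by (auto simp: partition_on_def)
  then have "partition_on (f ` A) ((`) f ` P)"
    using partition_on_inj_image[OF P(1) assms(1)] by simp
  moreover have "card (f ` e) = 2" if "e \<in> P" for e
    using P(2)[OF that] assms(1) by (metis card_image inj_on_subset)
  ultimately show ?thesis by (auto simp: pairings_def)
qed

lemma hafnian_image: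
  assumes "inj_on f A"
  shows "hafnian w (f ` A) = hafnian (\<lambda>e. w (f ` e)) A"
proof -
  let ?g = "inv_into A f"
  have g: "inj_on ?g (f ` A)" "?g ` f ` A = A"
    using assms by (auto simp: inj_on_inv_into)
  have sub: "\<Union>P \<subseteq> X" if "P \<in> pairings X" for P :: "'c set set" and X
    using that by (auto simp: pairings_def partition_on_def)
  have gf: "(`) ?g ` (`) f ` P = P" if P: "P \<in> pairings A" for P
  proof -
    have "?g ` f ` e = e" if "e \<in> P" for e
      using assms that P pairings_subset by (metis inv_into_image_cancel)
    then show ?thesis by (force simp: image_image)
  qed
  have fg: "(`) f ` (`) ?g ` Q = Q" if Q: "Q \<in> pairings (f ` A)" for Q
  proof -
    have "f ` ?g ` e = e" if "e \<in> Q" for e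
      using that Q pairings_subset by (metis image_inv_into_cancel)
    then show ?thesis by (force simp: image_image)
  qed
  have "bij_betw ((`) ((`) f)) (pairings A) (pairings (f ` A))"
  proof (rule bij_betwI[where g = "(`) ((`) ?g)"])
    show "(`) ((`) f) \<in> pairings A \<rightarrow> pairings (f ` A)"
      using image_mem_pairings[OF assms] by auto
    show "(`) ((`) ?g) \<in> pairings (f ` A) \<rightarrow> pairings A"
      using image_mem_pairings[OF g(1)] g(2) by auto
  qed (use gf fg in auto)
  then have "hafnian w (f ` A) = (\<Sum>P\<in>pairings A. \<Prod>e\<in>(`) f ` P. w e)"
    unfolding hafnian_def by (rule sum.reindex_bij_betw[symmetric])
  also have "\<dots> = hafnian (\<lambda>e. w (f ` e)) A"
    unfolding hafnian_def
  proof (intro sum.cong refl)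
    fix P assume P: "P \<in> pairings A"
    have "inj_on ((`) f) P"
      using inj_on_image_Pow[OF assms] by (rule inj_on_subset) (use P pairings_subset in blast)
    then show "(\<Prod>e\<in>(`) f ` P. w e) = (\<Prod>e\<in>P. w (f ` e))"
      by (simp add: prod.reindex)
  qed
  finally show ?thesis .
qed

text \<open>Matchings are sorted by the partner \<open>b\<close> of \<open>a\<close>; deleting the
  block \<open>{a, b}\<close> is a bijection onto the matchings of the other points.\<close>

lemma hafnian_rec:
  assumes fin: "finite A" and a: "a \<in> A"
  shows "hafnian w A = (\<Sum>b\<in>A - {a}. w {a, b} * hafnian w (A - {a, b}))"
proof -
  let ?S = "\<lambda>b. insert {a, b} ` pairings (A - {a, b})"
  have mem: "P \<in> pairings A \<longleftrightarrow> (\<exists>b\<in>A - {a}. P \<in> ?S b)" for P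
  proof
    assume P: "P \<in> pairings A"
    then obtain e where e: "e \<in> P" "a \<in> e"
      using a by (auto simp: pairings_def partition_on_def)
    then have e2: "card e = 2" "e \<subseteq> A" using P pairings_subset by blast+
    then obtain b where b: "e = {a, b}" "a \<noteq> b"
      using e(2) by (auto simp: card_2_iff)
    let ?Q = "P - {e}"
    have "disjnt e (\<Union>?Q)"
      using P e by (auto simp: pairings_def partition_on_def disjnt_iff pairwise_def)
    then have "partition_on (A - e) ?Q"
      using P e partition_on_insert[of e ?Q A] by (simp add: insert_absorb pairings_def)
    then have "?Q \<in> pairings (A - {a, b})"
      using P b by (auto simp: pairings_def)
    moreover have "P = insert {a, b} ?Q" using e b by auto
    ultimately show "\<exists>b\<in>A - {a}. P \<in> ?S b" using b e2 by blast
  next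
    assume "\<exists>b\<in>A - {a}. P \<in> ?S b"
    then obtain b Q where b: "b \<in> A" "b \<noteq> a" "P = insert {a, b} Q" "Q \<in> pairings (A - {a, b})"
      by blast
    have "disjnt {a, b} (\<Union>Q)"
      using b(4) by (auto simp: pairings_def partition_on_def disjnt_iff)
    then have "partition_on A P"
      using b a partition_on_insert[of "{a, b}" Q A] by (auto simp: pairings_def)
    then show "P \<in> pairings A" using b by (auto simp: pairings_def)
  qed
  have notin: "{a, b} \<notin> Q" if "Q \<in> pairings (A - {a, c})" for b c Q
    using that by (auto simp: pairings_def partition_on_def)
  have "pairings A = (\<Union>b\<in>A - {a}. ?S b)" by (rule Set.set_eqI) (simp only: mem UN_iff)
  moreover have "?S b \<inter> ?S c = {}" if "b \<in> A - {a}" "c \<in> A - {a}" "b \<noteq> c" for b c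
  proof -
    have "{a, b} \<noteq> {a, c}" using that by (auto simp: doubleton_eq_iff)
    then have "insert {a, b} P \<noteq> insert {a, c} Q" if "Q \<in> pairings (A - {a, c})" for P Q
      using notin[OF that, of b] by (metis insertE insertI1)
    then show ?thesis by (auto simp del: insert_iff)
  qed
  ultimately have "hafnian w A = (\<Sum>b\<in>A - {a}. \<Sum>P\<in>?S b. \<Prod>e\<in>P. w e)"
    unfolding hafnian_def using fin
    by (simp add: sum.UNION_disjoint finite_pairings)
  also have "\<dots> = (\<Sum>b\<in>A - {a}. w {a, b} * hafnian w (A - {a, b}))"
  proof (intro sum.cong refl)
    fix b
    have "inj_on (insert {a, b}) (pairings (A - {a, b}))"
      using notin by (intro inj_onI) (metis insert_ident)
    then have "(\<Sum>P\<in>?S b. \<Prod>e\<in>P. w e) =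
        (\<Sum>Q\<in>pairings (A - {a, b}). \<Prod>e\<in>insert {a, b} Q. w e)"
      by (simp add: sum.reindex)
    also have "\<dots> = (\<Sum>Q\<in>pairings (A - {a, b}). w {a, b} * (\<Prod>e\<in>Q. w e))"
    proof (intro sum.cong refl)
      fix Q assume Q: "Q \<in> pairings (A - {a, b})"
      have "finite Q" using Q fin finite_elements[of "A - {a, b}" Q] by (auto simp: pairings_def)
      then show "(\<Prod>e\<in>insert {a, b} Q. w e) = w {a, b} * (\<Prod>e\<in>Q. w e)"
        using notin[OF Q] by simp
    qed
    finally show "(\<Sum>P\<in>?S b. \<Prod>e\<in>P. w e) = w {a, b} * hafnian w (A - {a, b})"
      by (simp add: hafnian_def sum_distrib_left)
  qed
  finally show ?thesis .
qed

lemma pairing_sum_hafnian: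
  "pairing_sum B vs = hafnian (\<lambda>e. B (vs ! Min e) (vs ! Max e)) {..<length vs}"
  by (simp add: pairing_sum_def hafnian_def pairings_def)

lemma pairing_sum_Nil [simp]: "pairing_sum B [] = 1"
  by (simp add: pairing_sum_hafnian)

lemma card_2_less:
  fixes e :: "'a::linorder set"
  assumes "card e = 2"
  obtains i j where "e = {i, j}" "i < j"
  using assms by (metis card_2_iff insert_commute linorder_neqE)

lemma pairing_sum_map:
  "pairing_sum B (map f vs) = pairing_sum (\<lambda>i j. B (f i) (f j)) vs"
  unfolding pairing_sum_hafnian length_map
proof (rule hafnian_cong)
  fix e assume e: "e \<subseteq> {..<length vs}" "card e = 2"
  then obtain i j where "e = {i, j}" "i < j" by (auto elim: card_2_less)
  then show "B (map f vs ! Min e) (map f vs ! Max e) = B (f (vs ! Min e)) (f (vs ! Max e))"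
    using e by simp
qed

lemma pairing_sum_cong:
  assumes "\<And>u v. u \<in> set vs \<Longrightarrow> v \<in> set vs \<Longrightarrow> B u v = B' u v"
  shows "pairing_sum B vs = pairing_sum B' vs"
  unfolding pairing_sum_hafnian
proof (rule hafnian_cong)
  fix e assume e: "e \<subseteq> {..<length vs}" "card e = 2"
  then obtain i j where "e = {i, j}" "i < j" by (auto elim: card_2_less)
  then show "B (vs ! Min e) (vs ! Max e) = B' (vs ! Min e) (vs ! Max e)"
    using e assms by simp
qed

lemma pairing_sum_Cons:
  "pairing_sum B (v # ws) =
     (\<Sum>j<length ws. B v (ws ! j) * pairing_sum B (take j ws @ drop (Suc j) ws))"
proof -
  let ?vs = "v # ws"
  let ?w = "\<lambda>e. B (?vs ! Min e) (?vs ! Max e)"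
  have "pairing_sum B ?vs = (\<Sum>b\<in>{..<Suc (length ws)} - {0}.
      ?w {0, b} * hafnian ?w ({..<Suc (length ws)} - {0, b}))"
    unfolding pairing_sum_hafnian by (subst hafnian_rec[where a = 0]) auto
  also have "\<dots> = (\<Sum>j<length ws. ?w {0, Suc j} * hafnian ?w ({..<Suc (length ws)} - {0, Suc j}))"
    by (rule sum.reindex_bij_witness[where i = Suc and j = "\<lambda>b. b - 1"]) auto
  also have "\<dots> = (\<Sum>j<length ws. B v (ws ! j) * pairing_sum B (take j ws @ drop (Suc j) ws))"
  proof (intro sum.cong refl)
    fix j assume j: "j \<in> {..<length ws}"
    let ?us = "take j ws @ drop (Suc j) ws"
    \<comment> \<open>The increasing enumeration of the positions other than \<open>0\<close> and
      \<open>Suc j\<close>. Being increasing, it respects \<open>Min\<close> and \<open>Max\<close>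
      of every block, so \<open>B\<close> need not be symmetric here.\<close>
    define f where "f = (\<lambda>i. if i < j then Suc i else Suc (Suc i))"
    have smf: "strict_mono f" unfolding f_def by (rule strict_monoI) auto
    then have injf: "inj_on f X" for X by (metis strict_mono_eq inj_onI)
    have im: "f ` {..<length ws - 1} = {..<Suc (length ws)} - {0, Suc j}"
    proof (intro equalityI subsetI)
      fix i assume "i \<in> {..<Suc (length ws)} - {0, Suc j}"
      then have "i = f (if i \<le> j then i - 1 else i - 2)"
        "(if i \<le> j then i - 1 else i - 2) < length ws - 1"
        using j by (auto simp: f_def)
      then show "i \<in> f ` {..<length ws - 1}" by blast
    qed (use j in \<open>auto simp: f_def split: if_splits\<close>)
    have len: "length ?us = length ws - 1" using j by simp
    have nth: "?vs ! f i = ?us ! i" if "i < length ws - 1" for i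
      using that j by (auto simp: f_def nth_append min_def)
    have "hafnian ?w ({..<Suc (length ws)} - {0, Suc j}) =
        hafnian (\<lambda>e. ?w (f ` e)) {..<length ws - 1}"
      unfolding im[symmetric] by (rule hafnian_image[OF injf])
    also have "\<dots> = pairing_sum B ?us"
      unfolding pairing_sum_hafnian len
    proof (rule hafnian_cong)
      fix e assume e: "e \<subseteq> {..<length ws - 1}" "card e = 2"
      then obtain a b where ab: "e = {a, b}" "a < b" by (auto elim: card_2_less)
      then have "f a < f b" using smf by (simp add: strict_mono_less)
      then show "?w (f ` e) = B (?us ! Min e) (?us ! Max e)"
        using ab e nth[of a] nth[of b] by simp
    qed
    finally show "?w {0, Suc j} * hafnian ?w ({..<Suc (length ws)} - {0, Suc j}) =
        B v (ws ! j) * pairing_sum B ?us" by simp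
  qed
  finally show ?thesis .
qed

text \<open>A permutation of positions may exchange the two ends of a block, and this is where
  symmetry enters. It makes the pairing sum a function of the monomial rather than of the
  word.\<close>

lemma pairing_sum_mset_eq:
  assumes sym: "\<And>u v. u \<in> set vs \<Longrightarrow> v \<in> set vs \<Longrightarrow> B u v = B v u"
    and "mset us = mset vs"
  shows "pairing_sum B us = pairing_sum B vs"
proof -
  obtain p where p: "p permutes {..<length vs}" "permute_list p vs = us"
    using mset_eq_permutation[OF assms(2)] by blast
  have len: "length us = length vs" using assms(2) by (metis size_mset)
  have nth: "us ! i = vs ! p i" if "i < length vs" for i
    using p that by (auto simp: permute_list_nth)
  let ?w = "\<lambda>e. B (vs ! Min e) (vs ! Max e)"
  have "pairing_sum B vs = hafnian ?w (p ` {..<length vs})"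
    using p(1) by (simp add: pairing_sum_hafnian permutes_image)
  also have "\<dots> = hafnian (\<lambda>e. ?w (p ` e)) {..<length vs}"
    by (rule hafnian_image) (metis p(1) permutes_inj_on)
  also have "\<dots> = pairing_sum B us"
    unfolding pairing_sum_hafnian len
  proof (rule hafnian_cong)
    fix e assume e: "e \<subseteq> {..<length vs}" "card e = 2"
    then obtain i j where ij: "e = {i, j}" "i < j" by (auto elim: card_2_less)
    then have lt: "i < length vs" "j < length vs" using e by auto
    have "p i \<noteq> p j" using ij p(1) by (metis less_irrefl permutes_inj injD)
    moreover have "p i < length vs" "p j < length vs"
      using permutes_in_image[OF p(1)] lt by auto
    ultimately show "?w (p ` e) = B (us ! Min e) (us ! Max e)"
      using ij lt nth[of i] nth[of j] sym[of "vs ! p i" "vs ! p j"]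
      by (cases "p i < p j") (auto simp: min_def max_def)
  qed
  finally show ?thesis by simp
qed

section \<open>Multilinearity and symmetric powers of matrices\<close>

text \<open>
  The moments of the standard normal distribution: \<open>(n - 1)!!\<close> for even \<open>n\<close>, else \<open>0\<close>.
\<close>

fun normal_moment :: "nat \<Rightarrow> nat" where
  "normal_moment 0 = 1"
| "normal_moment (Suc 0) = 0"
| "normal_moment (Suc (Suc n)) = Suc n * normal_moment n"

lemma normal_moment_odd: "odd n \<Longrightarrow> normal_moment n = 0"
  by (induction n rule: normal_moment.induct) auto

lemma mset_remove_nth:
  assumes "j < length ws"
  shows "mset (take j ws @ drop (Suc j) ws) = mset ws - {#ws ! j#}"
proof -
  have "mset ws = mset (take j ws @ ws ! j # drop (Suc j) ws)"
    using assms by (simp add: id_take_nth_drop[symmetric])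
  then show ?thesis by simp
qed

text \<open>Wick's formula for independent variables of variance \<open>D i\<close>: only blocks of
  equal letters contribute. Pairing the first letter with each of its other occurrences reproduces
  the recursion of \<open>normal_moment\<close>.\<close>

lemma pairing_sum_diagonal:
  fixes D :: "nat \<Rightarrow> 'k::comm_ring_1"
  assumes "set w \<subseteq> {..d}"
  shows "pairing_sum (\<lambda>i j. if i = j then D i else 0) w =
    (\<Prod>i\<le>d. of_nat (normal_moment (count (mset w) i)) * D i ^ (count (mset w) i div 2))"
  using assms
proof (induction "length w" arbitrary: w rule: less_induct)
  case less
  let ?t = "\<lambda>M i. of_nat (normal_moment (count M i)) * D i ^ (count M i div 2)"
  define F where "F M = (\<Prod>i\<le>d. ?t M i)" for M
  show ?case
  proof (cases w)
    case Nil
    then show ?thesis by simp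
  next
    case (Cons v ws)
    let ?n = "count (mset ws) v"
    have v: "v \<le> d" using less.prems Cons by simp
    have "pairing_sum (\<lambda>i j. if i = j then D i else 0) w =
        (\<Sum>j<length ws. if ws ! j = v then D v * F (mset ws - {#v#}) else 0)"
      unfolding Cons pairing_sum_Cons
    proof (intro sum.cong refl, goal_cases)
      case (1 j)
      let ?us = "take j ws @ drop (Suc j) ws"
      have "set ?us \<subseteq> {..d}"
        using less.prems Cons set_take_subset[of j ws] set_drop_subset[of "Suc j" ws] by auto
      then have "pairing_sum (\<lambda>i j. if i = j then D i else 0) ?us = F (mset ?us)"
        unfolding F_def using 1 Cons by (intro less.hyps) auto
      then show ?case using 1 mset_remove_nth[of j ws] by (auto simp del: mset_append)
    qed
    also have "\<dots> = of_nat (card {j. j < length ws \<and> ws ! j = v}) * (D v * F (mset ws - {#v#}))"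
      by (subst sum.inter_filter[symmetric]) (auto simp: lessThan_def)
    also have "card {j. j < length ws \<and> ws ! j = v} = ?n"
    proof -
      have "count (mset ws) v = length (filter (\<lambda>y. y = v) ws)"
        by (induction ws) auto
      then show ?thesis by (simp add: length_filter_conv_card)
    qed
    also have "of_nat ?n * (D v * F (mset ws - {#v#})) = F (mset w)"
    proof -
      have rest: "(\<Prod>i\<in>{..d} - {v}. ?t (mset ws - {#v#}) i) = (\<Prod>i\<in>{..d} - {v}. ?t (mset w) i)"
        by (intro prod.cong) (auto simp: Cons)
      have cnt: "count (mset w) v = Suc ?n" "count (mset ws - {#v#}) v = ?n - 1"
        by (simp_all add: Cons)
      have "of_nat ?n * D v * ?t (mset ws - {#v#}) v = ?t (mset w) v"
      proof (cases ?n)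
        case 0
        then show ?thesis unfolding cnt 0 by simp
      next
        case (Suc c)
        then show ?thesis unfolding cnt Suc by (simp add: algebra_simps)
      qed
      then show ?thesis
        unfolding F_def using v rest
        by (simp add: prod.remove[of "{..d}" v] mult.assoc[symmetric])
    qed
    finally show ?thesis by (simp add: F_def)
  qed
qed

section \<open>Multilinear expansion over words\<close>

definition words :: "nat \<Rightarrow> nat \<Rightarrow> nat list set" where
  "words d n = {u. set u \<subseteq> {..d} \<and> length u = n}"

lemma finite_words [simp]: "finite (words d n)"
  unfolding words_def by (rule finite_lists_length_eq) simp

lemma words_0 [simp]: "words d 0 = {[]}"
  by (auto simp: words_def)

lemma sum_words_Suc: "(\<Sum>u\<in>words d (Suc n). f u) = (\<Sum>j\<le>d. \<Sum>u\<in>words d n. f (j # u))"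
proof -
  have "(\<Sum>u\<in>words d (Suc n). f u) = (\<Sum>p\<in>{..d} \<times> words d n. f (fst p # snd p))"
    by (rule sum.reindex_bij_witness[where i = "\<lambda>p. fst p # snd p" and j = "\<lambda>u. (hd u, tl u)"])
       (auto simp: words_def length_Suc_conv)
  then show ?thesis by (simp add: sum.cartesian_product case_prod_unfold)
qed

text \<open>The coefficient of the word \<open>u\<close> after each letter \<open>i\<close> of
  \<open>w\<close> is replaced by the linear form with coefficients \<open>A i j\<close> and the
  product is expanded without commuting letters.\<close>

definition word_coeff :: "(nat \<Rightarrow> nat \<Rightarrow> 'k::comm_ring_1) \<Rightarrow> nat list \<Rightarrow> nat list \<Rightarrow> 'k" where
  "word_coeff A w u = prod_list (map2 A w u)"

text \<open>\<open>pairing_sum_Cons\<close> exhibits linearity in the first entry only; symmetry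
  moves any other entry there.\<close>

lemma pairing_sum_linear:
  assumes sym: "\<And>u v. B u v = B v u"
    and lin: "\<And>z. B y z = (\<Sum>j\<le>d. c j * B (e j) z)"
  shows "pairing_sum B (us @ y # ws) = (\<Sum>j\<le>(d::nat). c j * pairing_sum B (us @ e j # ws))"
proof -
  have front: "pairing_sum B (us @ v # ws) = pairing_sum B (v # us @ ws)" for v
    by (rule pairing_sum_mset_eq) (auto intro: sym)
  show ?thesis
    unfolding front pairing_sum_Cons lin sum_distrib_right sum_distrib_left
    by (subst sum.swap) (simp add: mult.assoc)
qed

lemma pairing_sum_multilinear:
  assumes sym: "\<And>u v. B u v = B v u"
    and lin: "\<And>i z. B (y i) z = (\<Sum>j\<le>d. A i j * B (e j) z)"
  shows "pairing_sum B (us @ map y w) =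
    (\<Sum>u\<in>words d (length w). word_coeff A w u * pairing_sum B (us @ map e u))"
proof (induction w arbitrary: us)
  case Nil
  then show ?case by (simp add: word_coeff_def)
next
  case (Cons i w)
  have "pairing_sum B (us @ map y (i # w)) =
      (\<Sum>j\<le>d. A i j * pairing_sum B ((us @ [e j]) @ map y w))"
    using pairing_sum_linear[OF sym lin, of us i "map y w"] by simp
  also have "\<dots> = (\<Sum>u\<in>words d (length (i # w)). word_coeff A (i # w) u * pairing_sum B (us @ map e u))"
    unfolding Cons.IH length_Cons sum_words_Suc
    by (simp add: word_coeff_def sum_distrib_left mult.assoc)
  finally show ?case .
qed

lemma pairing_sum_congruence:
  fixes G :: "nat \<Rightarrow> nat \<Rightarrow> 'k::comm_ring_1"
  assumes sym: "\<And>a b. a \<le> d \<Longrightarrow> b \<le> d \<Longrightarrow> G a b = G b a"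
  shows "pairing_sum (\<lambda>i j. \<Sum>a\<le>d. \<Sum>b\<le>d. A i a * A j b * G a b) (w1 @ w2) =
    (\<Sum>u\<in>words d (length w1). \<Sum>v\<in>words d (length w2).
      word_coeff A w1 u * word_coeff A w2 v * pairing_sum G (u @ v))"
proof -
  \<comment> \<open>Letters become coordinate vectors: \<open>A i\<close> is a row and
    \<open>e j\<close> a unit vector. Cutting the sums at \<open>d\<close> makes \<open>B\<close>
    symmetric on all functions, although \<open>G\<close> is symmetric only on indices up to
    \<open>d\<close>.\<close>
  define B :: "(nat \<Rightarrow> 'k) \<Rightarrow> (nat \<Rightarrow> 'k) \<Rightarrow> 'k" where
    "B y z = (\<Sum>a\<le>d. \<Sum>b\<le>d. y a * z b * G a b)" for y z
  define e :: "nat \<Rightarrow> nat \<Rightarrow> 'k" where "e j = (\<lambda>m. if m = j then 1 else 0)" for j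
  have Bsym: "B y z = B z y" for y z
    unfolding B_def by (subst sum.swap) (auto intro!: sum.cong simp: sym mult.commute)
  have Be: "B (e i) z = (\<Sum>b\<le>d. z b * G i b)" if "i \<le> d" for i z
  proof -
    have "B (e i) z = (\<Sum>a\<le>d. if a = i then (\<Sum>b\<le>d. z b * G i b) else 0)"
      unfolding B_def e_def by (intro sum.cong refl) auto
    then show ?thesis using that by simp
  qed
  have lin: "B (A i) z = (\<Sum>j\<le>d. A i j * B (e j) z)" for i z
  proof -
    have "(\<Sum>j\<le>d. A i j * B (e j) z) = (\<Sum>j\<le>d. A i j * (\<Sum>b\<le>d. z b * G j b))"
      by (intro sum.cong refl) (simp add: Be)
    then show ?thesis by (simp add: B_def sum_distrib_left mult.assoc)
  qed
  have BG: "B (e i) (e j) = G i j" if "i \<le> d" "j \<le> d" for i j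
  proof -
    have "B (e i) (e j) = (\<Sum>b\<le>d. if b = j then G i j else 0)"
      unfolding Be[OF that(1)] by (intro sum.cong refl) (auto simp: e_def)
    then show ?thesis using that by simp
  qed
  \<comment> \<open>Multilinearity expands a suffix, so the halves trade places before the first one
    is expanded.\<close>
  have comm: "pairing_sum B (xs @ ys) = pairing_sum B (ys @ xs)" for xs ys
    by (rule pairing_sum_mset_eq) (auto intro: Bsym)
  have "pairing_sum (\<lambda>i j. \<Sum>a\<le>d. \<Sum>b\<le>d. A i a * A j b * G a b) (w1 @ w2) =
      pairing_sum B (map A w1 @ map A w2)"
    unfolding map_append[symmetric] pairing_sum_map by (simp add: B_def)
  also have "\<dots> = (\<Sum>v\<in>words d (length w2). word_coeff A w2 v *
      pairing_sum B (map A w1 @ map e v))"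
    by (rule pairing_sum_multilinear[where B = B and y = A and e = e and d = d, OF Bsym lin])
  also have "\<dots> = (\<Sum>v\<in>words d (length w2). \<Sum>u\<in>words d (length w1).
      word_coeff A w2 v * (word_coeff A w1 u * pairing_sum B (map e u @ map e v)))"
    unfolding comm[of "map A w1"] pairing_sum_multilinear[where B = B and y = A and e = e and d = d, OF Bsym lin] sum_distrib_left
    by (simp add: comm)
  also have "\<dots> = (\<Sum>u\<in>words d (length w1). \<Sum>v\<in>words d (length w2).
      word_coeff A w1 u * word_coeff A w2 v * pairing_sum B (map e (u @ v)))"
    by (subst sum.swap) (simp add: ac_simps)
  also have "\<dots> = (\<Sum>u\<in>words d (length w1). \<Sum>v\<in>words d (length w2).
      word_coeff A w1 u * word_coeff A w2 v * pairing_sum G (u @ v))"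
  proof (intro sum.cong refl)
    fix u v assume "u \<in> words d (length w1)" "v \<in> words d (length w2)"
    then have "pairing_sum B (map e (u @ v)) = pairing_sum G (u @ v)"
      unfolding pairing_sum_map by (intro pairing_sum_cong BG) (auto simp: words_def)
    then show "word_coeff A w1 u * word_coeff A w2 v * pairing_sum B (map e (u @ v)) =
        word_coeff A w1 u * word_coeff A w2 v * pairing_sum G (u @ v)" by simp
  qed
  finally show ?thesis .
qed

text \<open>Each letter can only decrease or stay. The sum of the letters detects any change and is
  unaffected by reordering, so it can order monomials as well as words.\<close>

lemma word_coeff_lower_triangular:
  assumes "\<And>i j. i < j \<Longrightarrow> A i j = 0" "length w = length u" "word_coeff A w u \<noteq> 0"
  shows "sum_list u \<le> sum_list w \<and> (sum_list u = sum_list w \<longrightarrow> u = w)"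
  using assms(2,3)
proof (induction w u rule: list_induct2)
  case (Cons i w j u)
  then have "A i j \<noteq> 0" "word_coeff A w u \<noteq> 0" by (auto simp: word_coeff_def)
  then show ?case using Cons.IH assms(1)[of i j] by (cases "i < j") auto
qed simp

section \<open>Words up to reordering, and symmetric powers of matrices\<close>

lemma index_word_mset:
  assumes "\<alpha> \<in> multi_indices d k"
  shows "count (mset (index_word d \<alpha>)) i = Poly_Mapping.lookup \<alpha> i"
proof -
  have "count (mset (concat (map (\<lambda>i. replicate (f i) i) [0..<n]))) i = (if i < n then f i else 0)"
    for f :: "nat \<Rightarrow> nat" and n
    by (induction n) (auto simp: less_Suc_eq)
  moreover have "Poly_Mapping.lookup \<alpha> i = 0" if "\<not> i < d + 1"
    using assms that by (auto simp: multi_indices_def in_keys_iff subset_iff not_less)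
  ultimately show ?thesis by (auto simp: index_word_def)
qed

lemma index_word_in_words:
  assumes "\<alpha> \<in> multi_indices d k"
  shows "index_word d \<alpha> \<in> words d k"
proof -
  have "length (concat (map (\<lambda>i. replicate (f i) i) [0..<n])) = (\<Sum>i<n. f i)"
    for f :: "nat \<Rightarrow> nat" and n
    by (induction n) auto
  then have "length (index_word d \<alpha>) = k"
    using assms by (simp add: index_word_def multi_indices_def lessThan_Suc_atMost del: upt_Suc)
  moreover have "set (index_word d \<alpha>) \<subseteq> {..d}"
    by (auto simp: index_word_def)
  ultimately show ?thesis by (simp add: words_def)
qed

definition word_content :: "nat list \<Rightarrow> nat \<Rightarrow>\<^sub>0 nat" where
  "word_content u = sum_list (map (\<lambda>i. Poly_Mapping.single i 1) u)"

lemma lookup_word_content: "Poly_Mapping.lookup (word_content u) i = count (mset u) i"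
  by (induction u) (auto simp: word_content_def lookup_add lookup_single)

lemma word_content_in_multi_indices:
  assumes "u \<in> words d k"
  shows "word_content u \<in> multi_indices d k"
proof -
  have "(\<Sum>i\<le>d. count (mset u) i) = length u" if "set u \<subseteq> {..d}"
    using that
  proof (induction u)
    case (Cons j u)
    have "(\<Sum>i\<le>d. count (mset (j # u)) i) = (\<Sum>i\<le>d. count (mset u) i + (if i = j then 1 else 0))"
      by (intro sum.cong) auto
    then show ?case using Cons by (simp only: sum.distrib) simp
  qed simp
  then show ?thesis
    using assms
    by (auto simp: multi_indices_def words_def lookup_word_content in_keys_iff count_eq_zero_iff
        simp del: count_mset_gt_0)
qed

lemma word_content_eq_iff:
  assumes "\<alpha> \<in> multi_indices d k"
  shows "word_content u = \<alpha> \<longleftrightarrow> mset u = mset (index_word d \<alpha>)"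
  by (auto simp: poly_mapping_eq_iff fun_eq_iff lookup_word_content multiset_eq_iff index_word_mset[OF assms])

definition sym_gram :: "(nat \<Rightarrow> nat \<Rightarrow> 'k::comm_ring_1) \<Rightarrow> nat \<Rightarrow> (nat \<Rightarrow>\<^sub>0 nat) \<Rightarrow> (nat \<Rightarrow>\<^sub>0 nat) \<Rightarrow> 'k" where
  "sym_gram G d \<alpha> \<beta> = pairing_sum G (index_word d \<alpha> @ index_word d \<beta>)"

text \<open>
  The matrix of \<open>Sym\<^sup>k A\<close> in the monomial basis; \<open>k\<close> is the length of the words involved.
\<close>

definition sym_power :: "(nat \<Rightarrow> nat \<Rightarrow> 'k::comm_ring_1) \<Rightarrow> nat \<Rightarrow> (nat \<Rightarrow>\<^sub>0 nat) \<Rightarrow> (nat \<Rightarrow>\<^sub>0 nat) \<Rightarrow> 'k" where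
  "sym_power A d \<alpha> \<beta> =
    (\<Sum>u | u \<in> words d (length (index_word d \<alpha>)) \<and> word_content u = \<beta>. word_coeff A (index_word d \<alpha>) u)"

text \<open>In matrix terms the new Gram matrix is \<open>S * Gram * S^T\<close> with
  \<open>S\<close> the matrix of \<open>sym_power A d\<close>. The expansion over words is grouped
  by content, on which alone \<open>pairing_sum G\<close> depends.\<close>

lemma sym_gram_congruence:
  fixes G :: "nat \<Rightarrow> nat \<Rightarrow> 'k::comm_ring_1"
  assumes sym: "\<And>a b. a \<le> d \<Longrightarrow> b \<le> d \<Longrightarrow> G a b = G b a"
    and "\<alpha> \<in> multi_indices d k" "\<beta> \<in> multi_indices d k"
  shows "sym_gram (\<lambda>i j. \<Sum>a\<le>d. \<Sum>b\<le>d. A i a * A j b * G a b) d \<alpha> \<beta> =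
    (\<Sum>\<gamma>\<in>multi_indices d k. \<Sum>\<delta>\<in>multi_indices d k.
       sym_power A d \<alpha> \<gamma> * sym_power A d \<beta> \<delta> * sym_gram G d \<gamma> \<delta>)"
proof -
  let ?M = "multi_indices d k" and ?W = "words d k"
  let ?w = "index_word d"
  have len: "length (?w \<alpha>) = k" "length (?w \<beta>) = k"
    using index_word_in_words assms(2,3) by (auto simp: words_def)
  have group: "(\<Sum>u\<in>?W. f u) = (\<Sum>\<gamma>\<in>?M. \<Sum>u | u \<in> ?W \<and> word_content u = \<gamma>. f u)" for f :: "nat list \<Rightarrow> 'k"
    by (rule sum.group[symmetric]) (use word_content_in_multi_indices finite_multi_indices in auto)
  have ps: "pairing_sum G (u @ v) = sym_gram G d \<gamma> \<delta>"
    if "\<gamma> \<in> ?M" "\<delta> \<in> ?M" "word_content u = \<gamma>" "word_content v = \<delta>" for u v \<gamma> \<delta>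
    unfolding sym_gram_def
  proof (rule pairing_sum_mset_eq)
    show "G a b = G b a" if "a \<in> set (?w \<gamma> @ ?w \<delta>)" "b \<in> set (?w \<gamma> @ ?w \<delta>)" for a b
      by (rule sym) (use that \<open>\<gamma> \<in> ?M\<close> \<open>\<delta> \<in> ?M\<close> index_word_in_words in \<open>auto simp: words_def subset_iff\<close>)
    show "mset (u @ v) = mset (?w \<gamma> @ ?w \<delta>)"
      using that word_content_eq_iff by simp
  qed
  have "sym_gram (\<lambda>i j. \<Sum>a\<le>d. \<Sum>b\<le>d. A i a * A j b * G a b) d \<alpha> \<beta> =
    (\<Sum>u\<in>?W. \<Sum>v\<in>?W. word_coeff A (?w \<alpha>) u * word_coeff A (?w \<beta>) v * pairing_sum G (u @ v))"
    unfolding sym_gram_def by (subst pairing_sum_congruence[OF sym]) (simp_all add: len)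
  also have "\<dots> = (\<Sum>\<gamma>\<in>?M. \<Sum>u | u \<in> ?W \<and> word_content u = \<gamma>. \<Sum>\<delta>\<in>?M. \<Sum>v | v \<in> ?W \<and> word_content v = \<delta>.
      word_coeff A (?w \<alpha>) u * word_coeff A (?w \<beta>) v * pairing_sum G (u @ v))"
    by (subst group, rule sum.cong[OF refl], rule sum.cong[OF refl], rule group)
  also have "\<dots> = (\<Sum>\<gamma>\<in>?M. \<Sum>\<delta>\<in>?M. \<Sum>u | u \<in> ?W \<and> word_content u = \<gamma>. \<Sum>v | v \<in> ?W \<and> word_content v = \<delta>.
      word_coeff A (?w \<alpha>) u * word_coeff A (?w \<beta>) v * pairing_sum G (u @ v))"
    by (rule sum.cong[OF refl], rule sum.swap)
  also have "\<dots> = (\<Sum>\<gamma>\<in>?M. \<Sum>\<delta>\<in>?M. \<Sum>u | u \<in> ?W \<and> word_content u = \<gamma>. \<Sum>v | v \<in> ?W \<and> word_content v = \<delta>.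
      word_coeff A (?w \<alpha>) u * word_coeff A (?w \<beta>) v * sym_gram G d \<gamma> \<delta>)"
    by (intro sum.cong refl arg_cong2[where f = "(*)"] ps) auto
  also have "\<dots> = (\<Sum>\<gamma>\<in>?M. \<Sum>\<delta>\<in>?M. sym_power A d \<alpha> \<gamma> * sym_power A d \<beta> \<delta> * sym_gram G d \<gamma> \<delta>)"
    unfolding sym_power_def len by (simp only: sum_product, simp only: sum_distrib_right)
  finally show ?thesis .
qed

lemma sym_power_lower_triangular:
  assumes "\<And>i j. i < j \<Longrightarrow> A i j = 0"
    and "\<alpha> \<in> multi_indices d k" "\<beta> \<in> multi_indices d k"
    and "sym_power A d \<alpha> \<beta> \<noteq> 0"
  shows "\<alpha> = \<beta> \<or> sum_list (index_word d \<beta>) < sum_list (index_word d \<alpha>)"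
proof -
  obtain u where u: "length u = length (index_word d \<alpha>)" "word_content u = \<beta>"
    "word_coeff A (index_word d \<alpha>) u \<noteq> 0"
    using sum.not_neutral_contains_not_neutral[OF assms(4)[unfolded sym_power_def]]
    by (auto simp: words_def)
  have "mset u = mset (index_word d \<beta>)" using u assms(3) word_content_eq_iff by blast
  then have "sum_list u = sum_list (index_word d \<beta>)" by (metis sum_mset_sum_list)
  moreover have "word_content (index_word d \<alpha>) = \<alpha>" using assms(2) word_content_eq_iff by blast
  moreover have "sum_list u \<le> sum_list (index_word d \<alpha>) \<and>
      (sum_list u = sum_list (index_word d \<alpha>) \<longrightarrow> u = index_word d \<alpha>)"
    using assms(1) u by (intro word_coeff_lower_triangular[of A]) auto
  ultimately show ?thesis using u(2) by (metis le_neq_implies_less)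
qed

text \<open>A rearrangement of the word has the same letter sum, so triangularity leaves only the
  word itself.\<close>

lemma sym_power_diagonal:
  fixes A :: "nat \<Rightarrow> nat \<Rightarrow> 'k::comm_ring_1"
  assumes "\<And>i j. i < j \<Longrightarrow> A i j = 0"
    and "\<alpha> \<in> multi_indices d k"
  shows "sym_power A d \<alpha> \<alpha> = (\<Prod>i\<le>d. A i i ^ Poly_Mapping.lookup \<alpha> i)"
proof -
  let ?w = "index_word d \<alpha>"
  let ?U = "{u. u \<in> words d (length ?w) \<and> word_content u = \<alpha>}"
  have w: "?w \<in> ?U"
    using assms(2) word_content_eq_iff index_word_in_words by (auto simp: words_def)
  have "word_coeff A ?w u = 0" if u: "u \<in> ?U - {?w}" for u
  proof (rule ccontr)
    assume nz: "word_coeff A ?w u \<noteq> 0"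
    have "mset u = mset ?w" using u assms(2) word_content_eq_iff by blast
    then have "sum_list u = sum_list ?w" by (metis sum_mset_sum_list)
    then show False
      using word_coeff_lower_triangular[OF assms(1) _ nz] u by (auto simp: words_def)
  qed
  then have "sym_power A d \<alpha> \<alpha> = word_coeff A ?w ?w"
    unfolding sym_power_def using w by (subst sum.remove[OF _ w]) auto
  also have "\<dots> = prod_list (map (\<lambda>i. A i i) ?w)"
    by (simp add: word_coeff_def zip_same_conv_map comp_def)
  also have "\<dots> = (\<Prod>i\<le>d. A i i ^ count (mset ?w) i)"
  proof -
    have "prod_list (map (\<lambda>i. A i i) w) = (\<Prod>i\<le>d. A i i ^ count (mset w) i)"
      if "set w \<subseteq> {..d}" for w
      using that
    proof (induction w)
      case (Cons j w)
      have "(\<Prod>i\<le>d. A i i ^ count (mset (j # w)) i) =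
          (\<Prod>i\<le>d. (if i = j then A j j else 1) * A i i ^ count (mset w) i)"
        by (intro prod.cong) auto
      then show ?case using Cons by (simp add: prod.distrib)
    qed simp
    then show ?thesis using index_word_in_words[OF assms(2)] by (simp add: words_def)
  qed
  finally show ?thesis by (simp add: index_word_mset[OF assms(2)])
qed

section \<open>Determinants of Gram matrices and counting multi-indices\<close>

lemma gram_matrix_carrier [simp]: "gram_matrix f l \<in> carrier_mat (length l) (length l)"
  by (simp add: gram_matrix_def)

lemma gram_matrix_dim [simp]:
  "dim_row (gram_matrix f l) = length l" "dim_col (gram_matrix f l) = length l"
  by (simp_all add: gram_matrix_def)

lemma gram_matrix_index [simp]:
  "i < length l \<Longrightarrow> j < length l \<Longrightarrow> gram_matrix f l $$ (i, j) = f (l ! i) (l ! j)"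
  by (simp add: gram_matrix_def)

lemma gram_matrix_cong:
  assumes "\<And>a b. a \<in> set l \<Longrightarrow> b \<in> set l \<Longrightarrow> f a b = g a b"
  shows "gram_matrix f l = gram_matrix g l"
  using assms by (intro eq_matI) auto

lemma gram_matrix_map: "gram_matrix f (map h l) = gram_matrix (\<lambda>a b. f (h a) (h b)) l"
  by (intro eq_matI) auto

lemma sum_set_nth:
  assumes "distinct l"
  shows "(\<Sum>a\<in>set l. h a) = (\<Sum>i<length l. h (l ! i))"
  using sum.reindex_bij_betw[OF bij_betw_nth[OF assms refl refl], of h] by simp

lemma prod_set_nth:
  assumes "distinct l"
  shows "(\<Prod>a\<in>set l. h a) = (\<Prod>i<length l. h (l ! i))"
  using prod.reindex_bij_betw[OF bij_betw_nth[OF assms refl refl], of h] by simp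

lemma gram_matrix_mult:
  fixes f g :: "'a \<Rightarrow> 'a \<Rightarrow> 'k::comm_ring_1"
  assumes "distinct l"
  shows "gram_matrix f l * gram_matrix g l = gram_matrix (\<lambda>a b. \<Sum>c\<in>set l. f a c * g c b) l"
  by (intro eq_matI)
    (auto simp: times_mat_def scalar_prod_def sum_set_nth[OF assms] lessThan_atLeast0)

lemma det_gram_mult:
  fixes f g :: "'a \<Rightarrow> 'a \<Rightarrow> 'k::comm_ring_1"
  assumes "distinct l"
  shows "det (gram_matrix (\<lambda>a b. \<Sum>c\<in>set l. f a c * g c b) l) =
    det (gram_matrix f l) * det (gram_matrix g l)"
  unfolding gram_matrix_mult[OF assms, symmetric]
  by (rule det_mult) auto

lemma det_gram_transpose:
  "det (gram_matrix (\<lambda>a b. f b a) l) = det (gram_matrix (f :: 'a \<Rightarrow> 'a \<Rightarrow> 'k::comm_ring_1) l)"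
proof -
  have "gram_matrix (\<lambda>a b. f b a) l = transpose_mat (gram_matrix f l)"
    by (intro eq_matI) auto
  then show ?thesis by (simp add: det_transpose[of _ "length l"])
qed

lemma det_gram_Leibniz:
  "det (gram_matrix f l) = (\<Sum>p | p permutes {..<length l}.
     signof p * (\<Prod>i<length l. f (l ! i) (l ! p i)))"
proof -
  have "det (gram_matrix f l) = (\<Sum>p | p permutes {0..<length l}.
     signof p * (\<Prod>i = 0..<length l. gram_matrix f l $$ (i, p i)))"
    by (rule det_def') simp
  also have "\<dots> = (\<Sum>p | p permutes {0..<length l}.
     signof p * (\<Prod>i = 0..<length l. f (l ! i) (l ! p i)))"
    by (intro sum.cong refl arg_cong2[where f = "(*)"] prod.cong gram_matrix_index)
       (auto dest: permutes_in_image)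
  finally show ?thesis by (simp add: lessThan_atLeast0)
qed

text \<open>The list is not sorted and \<open>key\<close> need not be injective. In a nonzero
  Leibniz term the permutation never raises \<open>key\<close> and lowers it at each moved position,
  while the total of \<open>key\<close> is invariant; so only the identity contributes.\<close>

lemma det_gram_triangular:
  fixes f :: "'a \<Rightarrow> 'a \<Rightarrow> 'k::comm_ring_1" and key :: "'a \<Rightarrow> nat"
  assumes "distinct l"
    and tri: "\<And>a b. a \<in> set l \<Longrightarrow> b \<in> set l \<Longrightarrow> f a b \<noteq> 0 \<Longrightarrow> a = b \<or> key b < key a"
  shows "det (gram_matrix f l) = (\<Prod>a\<in>set l. f a a)"
proof -
  let ?n = "length l"
  let ?P = "{p. p permutes {..<?n}}"
  let ?t = "\<lambda>p. signof p * (\<Prod>i<?n. f (l ! i) (l ! p i))"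
  have zero: "?t p = 0" if p: "p \<in> ?P - {id}" for p
  proof (rule ccontr)
    assume nz: "?t p \<noteq> 0"
    have perm: "p permutes {..<?n}" using p by simp
    have lt: "p i < ?n" if "i < ?n" for i
      using permutes_in_image[OF perm] that by auto
    have nzi: "f (l ! i) (l ! p i) \<noteq> 0" if "i < ?n" for i
    proof
      assume "f (l ! i) (l ! p i) = 0"
      then have "(\<Prod>i<?n. f (l ! i) (l ! p i)) = 0"
        using that by (intro prod_zero) auto
      then show False using nz by simp
    qed
    have step: "l ! i = l ! p i \<or> key (l ! p i) < key (l ! i)" if "i < ?n" for i
      using tri[OF _ _ nzi[OF that]] lt[OF that] that by simp
    have le: "key (l ! p i) \<le> key (l ! i)" if "i < ?n" for i
      using step[OF that] by (metis less_imp_le order_refl)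
    have "\<exists>i<?n. p i \<noteq> i"
      using p perm by (auto simp: fun_eq_iff permutes_def)
    then obtain i where i: "i < ?n" "p i \<noteq> i" by blast
    then have "key (l ! p i) < key (l ! i)"
      using step[OF i(1)] lt[OF i(1)] assms(1) by (auto simp: nth_eq_iff_index_eq)
    then have "(\<Sum>i<?n. key (l ! p i)) < (\<Sum>i<?n. key (l ! i))"
      using le i(1) by (intro sum_strict_mono_ex1) auto
    moreover have "(\<Sum>i<?n. key (l ! p i)) = (\<Sum>i<?n. key (l ! i))"
      using sum.permute[OF perm, of "\<lambda>i. key (l ! i)"] by (simp add: comp_def)
    ultimately show False by simp
  qed
  have fin: "finite ?P" by (rule finite_permutations) simp
  have id: "id \<in> ?P" by (simp add: permutes_id)
  have "det (gram_matrix f l) = (\<Sum>p\<in>?P. ?t p)"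
    by (rule det_gram_Leibniz)
  also have "\<dots> = ?t id"
    unfolding sum.remove[OF fin id] using zero by (simp add: sum.neutral)
  finally show ?thesis by (simp add: prod_set_nth[OF assms(1)] signof_id)
qed

lemma det_gram_scale_rows:
  fixes f :: "'a \<Rightarrow> 'a \<Rightarrow> 'k::comm_ring_1"
  assumes "distinct l"
  shows "det (gram_matrix (\<lambda>a b. c a * f a b) l) = (\<Prod>a\<in>set l. c a) * det (gram_matrix f l)"
  unfolding det_gram_Leibniz prod_set_nth[OF assms]
  by (simp add: prod.distrib sum_distrib_left ac_simps)

text \<open>With determinant 1 the adjugate is an inverse, so no division occurs.\<close>

lemma gram_matrix_solve:
  fixes f :: "'a \<Rightarrow> 'a \<Rightarrow> 'k::comm_ring_1"
  assumes "distinct l" "det (gram_matrix f l) = 1"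
  shows "\<exists>c. \<forall>a\<in>set l. u a = (\<Sum>b\<in>set l. f a b * c b)"
proof -
  let ?n = "length l"
  define A where "A = gram_matrix f l"
  define v where "v = vec ?n (\<lambda>i. u (l ! i))"
  define x where "x = adj_mat A *\<^sub>v v"
  define c where "c b = x $ (THE i. i < ?n \<and> l ! i = b)" for b
  have A: "A \<in> carrier_mat ?n ?n" by (simp add: A_def)
  have adj: "adj_mat A \<in> carrier_mat ?n ?n" "A * adj_mat A = 1\<^sub>m ?n"
    using adj_mat[OF A] assms(2) by (auto simp: A_def)
  have v: "v \<in> carrier_vec ?n" by (simp add: v_def)
  have "A *\<^sub>v x = (A * adj_mat A) *\<^sub>v v"
    unfolding x_def using A adj(1) v by (simp add: assoc_mult_mat_vec)
  then have Ax: "A *\<^sub>v x = v" using adj(2) v by simp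
  have x: "x \<in> carrier_vec ?n" unfolding x_def by (rule mult_mat_vec_carrier[OF adj(1) v])
  have c: "c (l ! i) = x $ i" if "i < ?n" for i
  proof -
    have "(THE j. j < ?n \<and> l ! j = l ! i) = i"
      using that assms(1) by (intro the_equality) (auto simp: nth_eq_iff_index_eq)
    then show ?thesis by (simp add: c_def)
  qed
  have "u a = (\<Sum>b\<in>set l. f a b * c b)" if "a \<in> set l" for a
  proof -
    obtain i where i: "i < ?n" "a = l ! i" using \<open>a \<in> set l\<close> by (auto simp: in_set_conv_nth)
    have "u a = (A *\<^sub>v x) $ i" using i by (simp add: Ax v_def)
    also have "\<dots> = (\<Sum>j<?n. f a (l ! j) * x $ j)"
      using i A x by (simp add: scalar_prod_def lessThan_atLeast0 A_def)
    also have "\<dots> = (\<Sum>b\<in>set l. f a b * c b)"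
      by (simp add: sum_set_nth[OF assms(1)] c)
    finally show ?thesis .
  qed
  then show ?thesis by blast
qed

text \<open>Formally, rows and columns are scaled by square roots of the \<open>D i\<close>, which
  need not exist. In a nonzero Leibniz term all exponent sums are even, and the halves add up over
  the permutation to the total exponent, whatever the permutation.\<close>

lemma det_gram_weights:
  fixes f :: "(nat \<Rightarrow>\<^sub>0 nat) \<Rightarrow> (nat \<Rightarrow>\<^sub>0 nat) \<Rightarrow> 'k::comm_ring_1"
  assumes "distinct l"
    and parity: "\<And>a b i. a \<in> set l \<Longrightarrow> b \<in> set l \<Longrightarrow> i \<le> d \<Longrightarrow>
      odd (Poly_Mapping.lookup a i + Poly_Mapping.lookup b i) \<Longrightarrow> f a b = 0"
  shows "det (gram_matrix (\<lambda>a b. f a b *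
      (\<Prod>i\<le>d. D i ^ ((Poly_Mapping.lookup a i + Poly_Mapping.lookup b i) div 2))) l) =
    det (gram_matrix f l) * (\<Prod>i\<le>d. D i ^ (\<Sum>a\<in>set l. Poly_Mapping.lookup a i))"
  unfolding det_gram_Leibniz sum_distrib_right
proof (intro sum.cong refl)
  let ?n = "length l"
  let ?L = "Poly_Mapping.lookup"
  fix p assume "p \<in> {p. p permutes {..<?n}}"
  then have perm: "p permutes {..<?n}" by simp
  have lt: "p i < ?n" if "i < ?n" for i
    using permutes_in_image[OF perm] that by auto
  let ?F = "\<Prod>x<?n. f (l ! x) (l ! p x)"
  let ?W = "\<Prod>x<?n. \<Prod>i\<le>d. D i ^ ((?L (l ! x) i + ?L (l ! p x) i) div 2)"
  let ?R = "\<Prod>i\<le>d. D i ^ (\<Sum>a\<in>set l. ?L a i)"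
  have "?F * ?W = ?F * ?R"
  proof (cases "\<forall>x<?n. \<forall>i\<le>d. even (?L (l ! x) i + ?L (l ! p x) i)")
    case True
    have "(\<Sum>x<?n. (?L (l ! x) i + ?L (l ! p x) i) div 2) = (\<Sum>a\<in>set l. ?L a i)" if "i \<le> d" for i
    proof -
      have "2 * (\<Sum>x<?n. (?L (l ! x) i + ?L (l ! p x) i) div 2) = (\<Sum>x<?n. ?L (l ! x) i + ?L (l ! p x) i)"
        using True that by (simp add: sum_distrib_left)
      also have "\<dots> = 2 * (\<Sum>x<?n. ?L (l ! x) i)"
        using sum.permute[OF perm, of "\<lambda>x. ?L (l ! x) i"] by (simp add: sum.distrib comp_def)
      finally show ?thesis by (simp add: sum_set_nth[OF assms(1)])
    qed
    then have "?W = ?R"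
      by (subst prod.swap) (auto intro!: prod.cong simp: power_sum[symmetric])
    then show ?thesis by simp
  next
    case False
    then obtain x i where xi: "x < ?n" "i \<le> d" "odd (?L (l ! x) i + ?L (l ! p x) i)" by blast
    then have "f (l ! x) (l ! p x) = 0" by (intro parity) (auto simp: lt)
    then have "?F = 0" using xi by (intro prod_zero) auto
    then show ?thesis by simp
  qed
  then show "signof p * (\<Prod>x<?n. f (l ! x) (l ! p x) *
      (\<Prod>i\<le>d. D i ^ ((?L (l ! x) i + ?L (l ! p x) i) div 2))) = signof p * ?F * ?R"
    by (simp add: prod.distrib mult.assoc)
qed

section \<open>Counting multi-indices\<close>

lemma card_multi_indices: "card (multi_indices d k) = (k + d) choose d"
proof -
  let ?f = "\<lambda>a. map (Poly_Mapping.lookup a) [0..<d + 1]"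
  have zero: "Poly_Mapping.lookup a i = 0" if "a \<in> multi_indices d k" "\<not> i < d + 1" for a i
    using that by (auto simp: multi_indices_def in_keys_iff subset_iff not_less)
  have "bij_betw ?f (multi_indices d k) {l. length l = d + 1 \<and> sum_list l = k}"
  proof (rule bij_betwI[where g = Poly_Mapping.nth])
    show "?f \<in> multi_indices d k \<rightarrow> {l. length l = d + 1 \<and> sum_list l = k}"
      by (auto simp: multi_indices_def interv_sum_list_conv_sum_set_nat lessThan_Suc_atMost
          atLeast0LessThan simp del: upt_Suc)
    show "Poly_Mapping.nth \<in> {l. length l = d + 1 \<and> sum_list l = k} \<rightarrow> multi_indices d k"
      by (auto simp: multi_indices_def sum_list_sum_nth nth.rep_eq nth_default_def in_keys_iff
          lessThan_Suc_atMost atLeast0LessThan simp del: keys_nth split: if_splits)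
    show "Poly_Mapping.nth (?f a) = a" if "a \<in> multi_indices d k" for a
      by (rule poly_mapping_eqI) (use zero[OF that] in \<open>auto simp: nth.rep_eq nth_default_def simp del: upt_Suc\<close>)
    show "?f (Poly_Mapping.nth l) = l" if "l \<in> {l. length l = d + 1 \<and> sum_list l = k}" for l
      using that by (auto intro!: nth_equalityI simp: nth.rep_eq nth_default_def simp del: upt_Suc)
  qed
  from bij_betw_same_card[OF this] have "card (multi_indices d k) = (k + (d + 1) - 1) choose k"
    using card_length_sum_list[of "d + 1" k] by simp
  then show ?thesis by (simp add: binomial_symmetric[of k "k + d"])
qed

lemma multi_indices_add:
  assumes "a \<in> multi_indices d m" "i \<le> d"
  shows "a + Poly_Mapping.single i c \<in> multi_indices d (m + c)"
proof -
  have "(\<Sum>j\<le>d. Poly_Mapping.lookup (a + Poly_Mapping.single i c) j) =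
      (\<Sum>j\<le>d. Poly_Mapping.lookup a j) + (\<Sum>j\<le>d. if i = j then c else 0)"
    by (simp add: lookup_add lookup_single when_def sum.distrib)
  then show ?thesis
    using assms by (auto simp: multi_indices_def in_keys_iff lookup_add lookup_single when_def subset_iff split: if_splits)
qed

lemma minus_single_add:
  fixes a :: "nat \<Rightarrow>\<^sub>0 nat"
  shows "c \<le> Poly_Mapping.lookup a i \<Longrightarrow> a - Poly_Mapping.single i c + Poly_Mapping.single i c = a"
  by (rule poly_mapping_eqI) (auto simp: lookup_add lookup_minus lookup_single when_def)

lemma multi_indices_diff:
  assumes "a \<in> multi_indices d m" "i \<le> d" "c \<le> Poly_Mapping.lookup a i"
  shows "a - Poly_Mapping.single i c \<in> multi_indices d (m - c) \<and> c \<le> m"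
proof -
  let ?a = "a - Poly_Mapping.single i c"
  have "(\<Sum>j\<le>d. Poly_Mapping.lookup a j) =
      (\<Sum>j\<le>d. Poly_Mapping.lookup (?a + Poly_Mapping.single i c) j)"
    using minus_single_add[OF assms(3)] by simp
  also have "\<dots> = (\<Sum>j\<le>d. Poly_Mapping.lookup ?a j) + (\<Sum>j\<le>d. if i = j then c else 0)"
    by (simp add: lookup_add lookup_single when_def sum.distrib)
  finally have "(\<Sum>j\<le>d. Poly_Mapping.lookup ?a j) + c = m"
    using assms by (simp add: multi_indices_def)
  then show ?thesis
    using assms(1) by (auto simp: multi_indices_def in_keys_iff lookup_minus subset_iff)
qed

lemma card_multi_indices_ge:
  assumes "i \<le> d" "m \<le> k"
  shows "card {a \<in> multi_indices d k. m \<le> Poly_Mapping.lookup a i} = (k - m + d) choose d"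
proof -
  let ?s = "Poly_Mapping.single i m"
  have "bij_betw (\<lambda>a. a + ?s) (multi_indices d (k - m))
      {a \<in> multi_indices d k. m \<le> Poly_Mapping.lookup a i}"
  proof (rule bij_betwI[where g = "\<lambda>a. a - ?s"])
    show "(\<lambda>a. a + ?s) \<in> multi_indices d (k - m) \<rightarrow> {a \<in> multi_indices d k. m \<le> Poly_Mapping.lookup a i}"
      using multi_indices_add[OF _ assms(1), of _ "k - m" m] assms(2)
      by (auto simp: lookup_add)
    show "(\<lambda>a. a - ?s) \<in> {a \<in> multi_indices d k. m \<le> Poly_Mapping.lookup a i} \<rightarrow> multi_indices d (k - m)"
      using multi_indices_diff[OF _ assms(1)] by auto
  qed (auto simp: minus_single_add)
  from bij_betw_same_card[OF this] show ?thesis by (simp add: card_multi_indices)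
qed

text \<open>The factor \<open>g j\<close> occurs once for each monomial whose exponent of
  \<open>x_i\<close> is at least \<open>c * j\<close>. The case \<open>c = 1\<close> serves the
  factorials, \<open>c = 2\<close> the scalars attached to powers of \<open>r^2\<close>.\<close>

lemma prod_multi_indices:
  fixes g :: "nat \<Rightarrow> 'k::comm_monoid_mult"
  assumes "i \<le> d" "0 < c"
  shows "(\<Prod>a\<in>multi_indices d k. \<Prod>j=1..Poly_Mapping.lookup a i div c. g j) =
    (\<Prod>j=1..k div c. g j ^ ((k - c * j + d) choose d))"
proof -
  let ?M = "multi_indices d k" and ?L = "Poly_Mapping.lookup"
  have "(\<Prod>a\<in>?M. \<Prod>j=1..?L a i div c. g j) =
      (\<Prod>a\<in>?M. \<Prod>j\<in>{1..k div c}. if c * j \<le> ?L a i then g j else 1)"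
  proof (rule prod.cong[OF refl])
    fix a assume "a \<in> ?M"
    then have "?L a i \<le> k"
      using assms(1) member_le_sum[of i "{..d}" "?L a"] by (auto simp: multi_indices_def)
    then have "{1..?L a i div c} = {j \<in> {1..k div c}. c * j \<le> ?L a i}"
      using assms(2) by (auto simp: less_eq_div_iff_mult_less_eq mult.commute)
    then show "(\<Prod>j=1..?L a i div c. g j) = (\<Prod>j\<in>{1..k div c}. if c * j \<le> ?L a i then g j else 1)"
      using prod.inter_filter[of "{1..k div c}" g "\<lambda>j. c * j \<le> ?L a i"] by simp
  qed
  also have "\<dots> = (\<Prod>j\<in>{1..k div c}. g j ^ card {a \<in> ?M. c * j \<le> ?L a i})"
    by (subst prod.swap) (simp add: prod.inter_filter[symmetric] finite_multi_indices)
  also have "\<dots> = (\<Prod>j=1..k div c. g j ^ ((k - c * j + d) choose d))"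
    using assms by (intro prod.cong refl)
      (simp add: card_multi_indices_ge less_eq_div_iff_mult_less_eq mult.commute)
  finally show ?thesis .
qed

text \<open>The source of the exponent of \<open>det G\<close>: counting by thresholds
  \<open>j\<close> and summing binomials along a diagonal of Pascal's triangle.\<close>

lemma sum_lookup_multi_indices:
  assumes "i \<le> d"
  shows "(\<Sum>a\<in>multi_indices d k. Poly_Mapping.lookup a i) = (d + k) choose (d + 1)"
proof -
  let ?M = "multi_indices d k" and ?L = "Poly_Mapping.lookup"
  have "(\<Sum>a\<in>?M. ?L a i) = (\<Sum>a\<in>?M. \<Sum>j\<in>{1..k}. if j \<le> ?L a i then 1 else 0)"
  proof (intro sum.cong refl)
    fix a assume "a \<in> ?M"
    then have "?L a i \<le> k"
      using assms(1) member_le_sum[of i "{..d}" "?L a"] by (auto simp: multi_indices_def)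
    then have "{j \<in> {1..k}. j \<le> ?L a i} = {1..?L a i}" by auto
    then show "?L a i = (\<Sum>j\<in>{1..k}. if j \<le> ?L a i then 1 else 0)"
      by (simp add: sum.inter_filter[symmetric])
  qed
  also have "\<dots> = (\<Sum>j\<in>{1..k}. card {a \<in> ?M. j \<le> ?L a i})"
    by (subst sum.swap) (simp add: sum.inter_filter[symmetric] finite_multi_indices)
  also have "\<dots> = (\<Sum>j\<in>{1..k}. (k - j + d) choose d)"
    using assms by (intro sum.cong refl) (simp add: card_multi_indices_ge)
  also have "\<dots> = (\<Sum>j<k. (j + d) choose d)"
    by (rule sum.reindex_bij_witness[where i = "\<lambda>j. k - j" and j = "\<lambda>j. k - j"]) auto
  also have "\<dots> = (d + k) choose (d + 1)"
    by (induction k) (auto simp: add.commute)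
  finally show ?thesis .
qed

section \<open>Gaussian moments and multiplication by the squared norm\<close>

definition index_moment :: "nat \<Rightarrow> (nat \<Rightarrow>\<^sub>0 nat) \<Rightarrow> rat" where
  "index_moment d a = (\<Prod>i\<le>d. of_nat (normal_moment (Poly_Mapping.lookup a i)))"

definition index_fact :: "nat \<Rightarrow> (nat \<Rightarrow>\<^sub>0 nat) \<Rightarrow> rat" where
  "index_fact d a = (\<Prod>i\<le>d. fact (Poly_Mapping.lookup a i))"

text \<open>
  A function \<open>f\<close> on multi-indices stands for the polynomial with coefficients \<open>f a\<close>. Then \<open>shift i c\<close>
  is multiplication by \<open>x\<^sub>i\<^sup>c\<close>, and \<open>radial d\<close> is multiplication by
  \<open>x\<^sub>0\<^sup>2 + \<dots> + x\<^sub>d\<^sup>2\<close>.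
\<close>

definition shift :: "nat \<Rightarrow> nat \<Rightarrow> ((nat \<Rightarrow>\<^sub>0 nat) \<Rightarrow> rat) \<Rightarrow> (nat \<Rightarrow>\<^sub>0 nat) \<Rightarrow> rat" where
  "shift i c f a = (if c \<le> Poly_Mapping.lookup a i then f (a - Poly_Mapping.single i c) else 0)"

definition radial :: "nat \<Rightarrow> ((nat \<Rightarrow>\<^sub>0 nat) \<Rightarrow> rat) \<Rightarrow> (nat \<Rightarrow>\<^sub>0 nat) \<Rightarrow> rat" where
  "radial d f a = (\<Sum>i\<le>d. shift i 2 f a)"

abbreviation unit_coeff :: "(nat \<Rightarrow>\<^sub>0 nat) \<Rightarrow> (nat \<Rightarrow>\<^sub>0 nat) \<Rightarrow> rat" where
  "unit_coeff b \<equiv> (\<lambda>a. of_bool (a = b))"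

lemma prod_update_single:
  fixes h :: "nat \<Rightarrow> 'a::comm_monoid_mult" and d :: nat
  assumes "i \<le> d"
  shows "(\<Prod>j\<le>d. h (Poly_Mapping.lookup (a + Poly_Mapping.single i c) j)) =
    h (Poly_Mapping.lookup a i + c) * (\<Prod>j\<in>{..d} - {i}. h (Poly_Mapping.lookup a j))"
proof -
  have "(\<Prod>j\<in>{..d} - {i}. h (Poly_Mapping.lookup (a + Poly_Mapping.single i c) j)) =
      (\<Prod>j\<in>{..d} - {i}. h (Poly_Mapping.lookup a j))"
    by (intro prod.cong) (auto simp: lookup_add lookup_single)
  then show ?thesis
    using assms by (subst prod.remove[of "{..d}" i]) (auto simp: lookup_add)
qed

lemma index_moment_add_2:
  assumes "i \<le> d"
  shows "index_moment d (a + Poly_Mapping.single i 2) =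
    of_nat (Poly_Mapping.lookup a i + 1) * index_moment d a"
proof -
  have "index_moment d a = of_nat (normal_moment (Poly_Mapping.lookup a i)) *
      (\<Prod>j\<in>{..d} - {i}. of_nat (normal_moment (Poly_Mapping.lookup a j)))"
    unfolding index_moment_def using assms by (subst prod.remove[of _ i]) auto
  then show ?thesis
    using prod_update_single[OF assms, of "\<lambda>n. of_nat (normal_moment n) :: rat" a 2]
    by (simp add: index_moment_def numeral_2_eq_2 distrib_right)
qed

text \<open>Gaussian integration by parts, \<open>E[x_i p] = E[dp/dx_i]\<close>, on monomials. For
  exponent 0 the truncated subtraction is harmless because its coefficient vanishes.\<close>

lemma index_moment_add_1:
  assumes "i \<le> d"
  shows "index_moment d (a + Poly_Mapping.single i 1) =
    of_nat (Poly_Mapping.lookup a i) * index_moment d (a - Poly_Mapping.single i 1)"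
proof (cases "Poly_Mapping.lookup a i = 0")
  case True
  have "normal_moment (Poly_Mapping.lookup a i + 1) = 0" by (simp add: True)
  then show ?thesis
    using prod_update_single[OF assms, of "\<lambda>n. of_nat (normal_moment n) :: rat" a 1]
    by (simp add: index_moment_def True)
next
  case False
  let ?b = "a - Poly_Mapping.single i 1"
  have ab: "?b + Poly_Mapping.single i 1 = a"
    using False by (intro minus_single_add) simp
  have "a + Poly_Mapping.single i 1 = ?b + (Poly_Mapping.single i 1 + Poly_Mapping.single i 1)"
    by (simp only: ab flip: add.assoc)
  also have "\<dots> = ?b + Poly_Mapping.single i 2"
    by (simp only: single_add[symmetric] one_add_one)
  finally show ?thesis
    using index_moment_add_2[OF assms, of ?b] False
    by (simp add: lookup_minus)
qed

lemma index_fact_add_1: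
  assumes "i \<le> d"
  shows "index_fact d (a + Poly_Mapping.single i 1) =
    of_nat (Poly_Mapping.lookup a i + 1) * index_fact d a"
proof -
  have "index_fact d a = fact (Poly_Mapping.lookup a i) *
      (\<Prod>j\<in>{..d} - {i}. fact (Poly_Mapping.lookup a j))"
    unfolding index_fact_def using assms by (subst prod.remove[of _ i]) auto
  then show ?thesis
    using prod_update_single[OF assms, of "fact :: nat \<Rightarrow> rat" a 1]
    by (simp add: index_fact_def)
qed

lemma index_fact_shift_1:
  assumes "i \<le> d" "1 \<le> Poly_Mapping.lookup a i"
  shows "index_fact d a =
    of_nat (Poly_Mapping.lookup a i) * index_fact d (a - Poly_Mapping.single i 1)"
  using index_fact_add_1[OF assms(1), of "a - Poly_Mapping.single i 1"] assms(2)
  by (simp add: minus_single_add lookup_minus)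

lemma index_fact_shift_2:
  assumes "i \<le> d" "2 \<le> Poly_Mapping.lookup a i"
  shows "index_fact d a = of_nat (Poly_Mapping.lookup a i) * of_nat (Poly_Mapping.lookup a i - 1) *
    index_fact d (a - Poly_Mapping.single i 2)"
proof -
  have "a - Poly_Mapping.single i 1 - Poly_Mapping.single i 1 = a - Poly_Mapping.single i 2"
    by (rule poly_mapping_eqI) (auto simp: lookup_minus lookup_single when_def)
  then show ?thesis
    using index_fact_shift_1[OF assms(1), of a]
      index_fact_shift_1[OF assms(1), of "a - Poly_Mapping.single i 1"] assms(2)
    by (simp add: lookup_minus)
qed

lemma index_moment_shift_2:
  assumes "i \<le> d" "2 \<le> Poly_Mapping.lookup a i"
  shows "index_moment d a =
    of_nat (Poly_Mapping.lookup a i - 1) * index_moment d (a - Poly_Mapping.single i 2)"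
  using index_moment_add_2[OF assms(1), of "a - Poly_Mapping.single i 2"] assms(2)
  by (simp add: minus_single_add lookup_minus Suc_diff_Suc numeral_2_eq_2 del: of_nat_Suc)

lemma index_moment_eq_0:
  assumes "i \<le> d" "odd (Poly_Mapping.lookup a i)"
  shows "index_moment d a = 0"
  using assms unfolding index_moment_def
  by (intro prod_zero) (auto simp: normal_moment_odd intro!: bexI[of _ i])

section \<open>Calculus of multiplication by variables and by the squared norm\<close>

lemma shift_commute: "shift i c (shift j e f) = shift j e (shift i c f)"
proof
  fix a :: "nat \<Rightarrow>\<^sub>0 nat"
  have "a - Poly_Mapping.single i c - Poly_Mapping.single j e =
      a - Poly_Mapping.single j e - Poly_Mapping.single i c"
    by (rule poly_mapping_eqI) (auto simp: lookup_minus)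
  then show "shift i c (shift j e f) a = shift j e (shift i c f) a"
    by (auto simp: shift_def lookup_minus lookup_single when_def)
qed

lemma shift_sum: "shift i c (\<lambda>a. \<Sum>x\<in>S. h x a) a = (\<Sum>x\<in>S. shift i c (h x) a)"
  by (simp add: shift_def)

lemma shift_radial: "shift i c (radial d f) = radial d (shift i c f)"
  by (rule ext) (simp add: radial_def[abs_def] shift_sum shift_commute)

lemma shift_radial_pow: "shift i c ((radial d ^^ j) f) = (radial d ^^ j) (shift i c f)"
  by (induction j) (simp_all add: shift_radial)

lemma radial_linear:
  "radial d (\<lambda>a. \<Sum>x\<in>S. c x * h x a) = (\<lambda>a. \<Sum>x\<in>S. c x * radial d (h x) a)"
proof
  fix a
  have "shift i 2 (\<lambda>a. \<Sum>x\<in>S. c x * h x a) a = (\<Sum>x\<in>S. c x * shift i 2 (h x) a)" for i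
    by (simp add: shift_def)
  then show "radial d (\<lambda>a. \<Sum>x\<in>S. c x * h x a) a = (\<Sum>x\<in>S. c x * radial d (h x) a)"
    by (simp add: radial_def sum_distrib_left sum.swap[of _ S])
qed

lemma radial_pow_linear:
  "(radial d ^^ j) (\<lambda>a. \<Sum>x\<in>S. c x * h x a) = (\<lambda>a. \<Sum>x\<in>S. c x * (radial d ^^ j) (h x) a)"
  by (induction j) (simp_all add: radial_linear)

lemma radial_pow_add_scale:
  "(radial d ^^ j) (\<lambda>a. f a + c * g a) a = (radial d ^^ j) f a + c * (radial d ^^ j) g a"
  using radial_pow_linear[of j d "\<lambda>b. if b then 1 else c" "\<lambda>b. if b then f else g" UNIV]
  by (simp add: UNIV_bool add.commute)

lemma radial_pow_scale:
  "(radial d ^^ j) (\<lambda>a. c * g a) a = c * (radial d ^^ j) g a"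
  using radial_pow_linear[of j d "\<lambda>_. c" "\<lambda>_. g" "{()}"] by simp

lemma radial_pow_Suc_right: "(radial d ^^ j) (radial d f) = (radial d ^^ Suc j) f"
  by (simp add: funpow_swap1)

lemma radial_pow_cong:
  assumes "\<And>b. b \<in> multi_indices d m \<Longrightarrow> f b = g b" "a \<in> multi_indices d (m + 2 * j)"
  shows "(radial d ^^ j) f a = (radial d ^^ j) g a"
  using assms(2)
proof (induction j arbitrary: a)
  case 0
  then show ?case using assms(1) by simp
next
  case (Suc j)
  have "shift i 2 ((radial d ^^ j) f) a = shift i 2 ((radial d ^^ j) g) a" if "i \<le> d" for i
    using Suc.IH[of "a - Poly_Mapping.single i 2"] multi_indices_diff[OF Suc.prems that, of 2]
    by (auto simp: shift_def)
  then show ?case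
    by (simp add: radial_def[of d "(radial d ^^ j) f" a] radial_def[of d "(radial d ^^ j) g" a])
qed

lemma radial_pow_eq_0:
  assumes "a \<in> multi_indices d k" "k < 2 * j"
  shows "(radial d ^^ j) f a = 0"
  using assms
proof (induction j arbitrary: a k)
  case (Suc j)
  have "shift i 2 ((radial d ^^ j) f) a = 0" if "i \<le> d" for i
    using Suc.IH[of "a - Poly_Mapping.single i 2" "k - 2"] Suc.prems(2)
      multi_indices_diff[OF Suc.prems(1) that, of 2]
    by (auto simp: shift_def)
  then show ?case by (simp add: radial_def[of d "(radial d ^^ j) f" a])
qed simp

text \<open>The case \<open>b = 0\<close> of the expansion below, without remainder. Dividing by
  \<open>x_i^2\<close> leaves a factor equal to the exponent of \<open>x_i\<close>, and these
  exponents sum to the degree \<open>2 * Suc j\<close>, which turns \<open>2^j j!\<close> into the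
  next constant.\<close>

lemma radial_pow_moment:
  assumes "a \<in> multi_indices d (2 * j)"
  shows "(radial d ^^ j) (unit_coeff 0) a * index_fact d a = 2 ^ j * fact j * index_moment d a"
  using assms
proof (induction j arbitrary: a)
  case 0
  then have "a = 0"
    by (intro poly_mapping_eqI) (auto simp: multi_indices_def in_keys_iff subset_iff)
  then show ?case by (simp add: index_fact_def index_moment_def)
next
  case (Suc j)
  let ?L = "Poly_Mapping.lookup a"
  have "shift i 2 ((radial d ^^ j) (unit_coeff 0)) a * index_fact d a =
      2 ^ j * fact j * of_nat (?L i) * index_moment d a" if i: "i \<le> d" for i
  proof (cases "2 \<le> ?L i")
    case True
    let ?b = "a - Poly_Mapping.single i 2"
    have "?b \<in> multi_indices d (2 * j)"
      using multi_indices_diff[OF Suc.prems i True] by simp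
    note IH = Suc.IH[OF this]
    have "shift i 2 ((radial d ^^ j) (unit_coeff 0)) a * index_fact d a =
        of_nat (?L i) * of_nat (?L i - 1) * ((radial d ^^ j) (unit_coeff 0) ?b * index_fact d ?b)"
      using True by (simp add: shift_def index_fact_shift_2[OF i True])
    then show ?thesis
      unfolding IH index_moment_shift_2[OF i True] by simp
  next
    case False
    then have "?L i = 0 \<or> odd (?L i)" by (auto simp: not_le less_2_cases_iff)
    then show ?thesis
      using False index_moment_eq_0[OF i, of a] by (auto simp: shift_def)
  qed
  then have "(radial d ^^ Suc j) (unit_coeff 0) a * index_fact d a =
      (\<Sum>i\<le>d. 2 ^ j * fact j * of_nat (?L i) * index_moment d a)"
    by (simp add: radial_def[of d "(radial d ^^ j) (unit_coeff 0)" a] sum_distrib_right)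
  also have "\<dots> = 2 ^ j * fact j * of_nat (\<Sum>i\<le>d. ?L i) * index_moment d a"
    by (simp add: sum_distrib_left sum_distrib_right)
  also have "(\<Sum>i\<le>d. ?L i) = 2 * Suc j"
    using Suc.prems by (simp add: multi_indices_def)
  finally show ?case by (simp add: algebra_simps)
qed

lemma shift_unit_coeff: "shift i c (unit_coeff b) = unit_coeff (b + Poly_Mapping.single i c)"
proof
  fix a
  have "c \<le> Poly_Mapping.lookup a i \<and> a - Poly_Mapping.single i c = b \<longleftrightarrow> a = b + Poly_Mapping.single i c"
    by (metis add_diff_cancel_right' le_add2 lookup_add lookup_single_eq minus_single_add)
  then show "shift i c (unit_coeff b) a = unit_coeff (b + Poly_Mapping.single i c) a"
    by (auto simp: shift_def)
qed

text \<open>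
  Write \<open>r\<^sup>2\<close> for the squared norm and \<open>\<langle>p, q\<rangle>\<close> for the inner product that makes the
  monomials orthogonal with \<open>\<langle>x\<^sup>a, x\<^sup>a\<rangle> = a!\<close>; the operators \<open>x\<^sub>i\<close> and \<open>\<partial>\<^sub>i\<close> are adjoint for it.
  Integration by parts turns a Gaussian expectation \<open>E[x\<^sup>a x\<^sup>b]\<close> with \<open>|a| = |b| + 2j\<close> into
  \<open>\<langle>x\<^sup>a, q\<rangle>\<close> for some \<open>q\<close> that agrees with \<open>r\<^bsup>2j\<^esup>x\<^sup>b / (2\<^sup>j j!)\<close> modulo multiples of \<open>r\<^bsup>2j+2\<^esup>\<close>.
\<close>

lemma index_moment_expansion:
  assumes "b \<in> multi_indices d m"
  shows "\<exists>u. \<forall>a\<in>multi_indices d (m + 2 * j). index_moment d (a + b) =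
    index_fact d a * ((radial d ^^ j) (unit_coeff b) a / (2 ^ j * fact j) + (radial d ^^ Suc j) u a)"
  using assms
proof (induction m arbitrary: j b rule: less_induct)
  case (less m)
  show ?case
  proof (cases "m = 0")
    case True
    then have b: "b = 0"
      using less.prems by (intro poly_mapping_eqI) (auto simp: multi_indices_def in_keys_iff subset_iff)
    have "(radial d ^^ Suc j) (\<lambda>_. 0) a = 0" for a
      using radial_pow_scale[of "Suc j" d 0 "\<lambda>_. 0" a] by simp
    then have "index_moment d (a + b) = index_fact d a *
        ((radial d ^^ j) (unit_coeff b) a / (2 ^ j * fact j) + (radial d ^^ Suc j) (\<lambda>_. 0) a)"
      if "a \<in> multi_indices d (m + 2 * j)" for a
      using radial_pow_moment[of a d j] that True b by (simp add: field_simps)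
    then show ?thesis by blast
  next
    case False
    have "\<exists>i\<le>d. 1 \<le> Poly_Mapping.lookup b i"
    proof (rule ccontr)
      assume "\<not> (\<exists>i\<le>d. 1 \<le> Poly_Mapping.lookup b i)"
      then have "Poly_Mapping.lookup b i = 0" if "i \<le> d" for i
        using that by (cases "Poly_Mapping.lookup b i") auto
      then have "(\<Sum>i\<le>d. Poly_Mapping.lookup b i) = 0" by simp
      then show False using False less.prems by (simp add: multi_indices_def)
    qed
    then obtain i where i: "i \<le> d" "1 \<le> Poly_Mapping.lookup b i" by blast
    let ?e = "Poly_Mapping.single i 1 :: nat \<Rightarrow>\<^sub>0 nat"
    let ?L = Poly_Mapping.lookup
    define b1 where "b1 = b - ?e"
    have b1: "b1 \<in> multi_indices d (m - 1)" "b = b1 + ?e"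
      using multi_indices_diff[OF less.prems i] minus_single_add[OF i(2)] by (simp_all add: b1_def)
    obtain u1 where u1: "\<And>a. a \<in> multi_indices d (m - 1 + 2 * j) \<Longrightarrow> index_moment d (a + b1) =
        index_fact d a * ((radial d ^^ j) (unit_coeff b1) a / (2 ^ j * fact j) + (radial d ^^ Suc j) u1 a)"
      using less.IH[OF _ b1(1), of j] False by auto
    \<comment> \<open>The derivative falls on \<open>x^a\<close>. Since differentiation and
      multiplication by \<open>x_i\<close> are adjoint, the hypothesis for \<open>b1\<close> gets
      multiplied by \<open>x_i\<close>, which commutes with \<open>radial d\<close>.\<close>
    have first: "of_nat (?L a i) * index_moment d (a - ?e + b1) =
        index_fact d a * ((radial d ^^ j) (unit_coeff b) a / (2 ^ j * fact j) +
          (radial d ^^ Suc j) (shift i 1 u1) a)"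
      if a: "a \<in> multi_indices d (m + 2 * j)" for a
    proof (cases "1 \<le> ?L a i")
      case True
      have "a - ?e \<in> multi_indices d (m - 1 + 2 * j)"
        using multi_indices_diff[OF a i(1) True] False by simp
      note u1[OF this]
      moreover have "(radial d ^^ j) (unit_coeff b1) (a - ?e) = (radial d ^^ j) (unit_coeff b) a"
        using shift_radial_pow[of i 1 j d "unit_coeff b1"] True
        unfolding b1(2) shift_unit_coeff[symmetric] by (metis shift_def)
      moreover have "(radial d ^^ Suc j) u1 (a - ?e) = (radial d ^^ Suc j) (shift i 1 u1) a"
        using shift_radial_pow[of i 1 "Suc j" d u1] True by (metis shift_def)
      ultimately show ?thesis
        by (simp only: index_fact_shift_1[OF i(1) True] mult.assoc)
    next
      case False
      have "shift i 1 ((radial d ^^ j) (unit_coeff b1)) a = 0"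
        "shift i 1 ((radial d ^^ Suc j) u1) a = 0"
        using False by (auto simp: shift_def)
      then have "(radial d ^^ j) (unit_coeff b) a = 0" "(radial d ^^ Suc j) (shift i 1 u1) a = 0"
        unfolding shift_radial_pow shift_unit_coeff b1(2) by auto
      then show ?thesis using False by simp
    qed
    \<comment> \<open>The derivative falls on the rest of \<open>x^b\<close>. The degree
      \<open>m\<close> drops by 2 while that of \<open>a\<close> stays, so the hypothesis applies
      with \<open>Suc j\<close>: this whole term is a multiple of \<open>r^(2j+2)\<close> and joins
      the remainder.\<close>
    have "\<exists>v. \<forall>a\<in>multi_indices d (m + 2 * j).
        of_nat (?L b1 i) * index_moment d (a + (b1 - ?e)) = index_fact d a * (radial d ^^ Suc j) v a"
    proof (cases "1 \<le> ?L b1 i")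
      case True
      have b2: "b1 - ?e \<in> multi_indices d (m - 2)" "2 \<le> m"
        using multi_indices_diff[OF b1(1) i(1) True] False by (auto simp: numeral_2_eq_2)
      obtain u2 where u2: "\<And>a. a \<in> multi_indices d (m - 2 + 2 * Suc j) \<Longrightarrow>
          index_moment d (a + (b1 - ?e)) = index_fact d a *
          ((radial d ^^ Suc j) (unit_coeff (b1 - ?e)) a / (2 ^ Suc j * fact (Suc j)) + (radial d ^^ Suc (Suc j)) u2 a)"
        using less.IH[OF _ b2(1), of "Suc j"] b2(2) by auto
      define v where "v = (\<lambda>a. radial d u2 a + 1 / (2 ^ Suc j * fact (Suc j)) * unit_coeff (b1 - ?e) a)"
      have v: "(radial d ^^ Suc j) v a = (radial d ^^ Suc j) (unit_coeff (b1 - ?e)) a / (2 ^ Suc j * fact (Suc j)) +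
          (radial d ^^ Suc (Suc j)) u2 a" for a
        unfolding v_def radial_pow_add_scale radial_pow_Suc_right by (simp only: times_divide_eq_left mult_1 add.commute)
      have "of_nat (?L b1 i) * index_moment d (a + (b1 - ?e)) =
          index_fact d a * (radial d ^^ Suc j) (\<lambda>a. of_nat (?L b1 i) * v a) a"
        if "a \<in> multi_indices d (m + 2 * j)" for a
      proof -
        have "a \<in> multi_indices d (m - 2 + 2 * Suc j)"
        proof -
          have "m - 2 + 2 * Suc j = m + 2 * j" using b2(2) by simp
          then show ?thesis using that by (simp only:)
        qed
        from u2[OF this] show ?thesis
          unfolding radial_pow_scale v by (simp only: mult.left_commute)
      qed
      then show ?thesis by blast
    next
      case False
      have "(radial d ^^ Suc j) (\<lambda>_. 0) a = 0" for a
        using radial_pow_scale[of "Suc j" d 0 "\<lambda>_. 0" a] by simp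
      then show ?thesis using False by (intro exI[of _ "\<lambda>_. 0"]) simp
    qed
    then obtain v where second: "\<And>a. a \<in> multi_indices d (m + 2 * j) \<Longrightarrow>
        of_nat (?L b1 i) * index_moment d (a + (b1 - ?e)) = index_fact d a * (radial d ^^ Suc j) v a"
      by blast
    have "index_moment d (a + b) = index_fact d a * ((radial d ^^ j) (unit_coeff b) a / (2 ^ j * fact j) +
        (radial d ^^ Suc j) (\<lambda>a. shift i 1 u1 a + 1 * v a) a)"
      if a: "a \<in> multi_indices d (m + 2 * j)" for a
    proof -
      have "index_moment d (a + b) = of_nat (?L a i + ?L b1 i) * index_moment d (a + b1 - ?e)"
        using index_moment_add_1[OF i(1), of "a + b1"] by (simp add: b1(2) add.assoc lookup_add)
      also have "\<dots> = of_nat (?L a i) * index_moment d (a + b1 - ?e) + of_nat (?L b1 i) * index_moment d (a + b1 - ?e)"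
        by (simp add: distrib_right)
      \<comment> \<open>Truncated subtraction can be moved onto one summand only if that summand has
        a positive exponent of \<open>x_i\<close>; otherwise the coefficient is 0. The same applies
        to \<open>b1\<close> below.\<close>
      also have "of_nat (?L a i) * index_moment d (a + b1 - ?e) = of_nat (?L a i) * index_moment d (a - ?e + b1)"
      proof (cases "?L a i = 0")
        case False
        then have "a + b1 - ?e = a - ?e + b1"
          by (intro poly_mapping_eqI) (auto simp: lookup_add lookup_minus lookup_single when_def)
        then show ?thesis by simp
      qed simp
      also have "of_nat (?L b1 i) * index_moment d (a + b1 - ?e) = of_nat (?L b1 i) * index_moment d (a + (b1 - ?e))"
      proof (cases "?L b1 i = 0")
        case False
        then have "a + b1 - ?e = a + (b1 - ?e)"
          by (intro poly_mapping_eqI) (auto simp: lookup_add lookup_minus lookup_single when_def)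
        then show ?thesis by simp
      qed simp
      finally show ?thesis
        unfolding first[OF a] second[OF a] radial_pow_add_scale by (simp only: distrib_left mult_1 add.assoc)
    qed
    then show ?thesis by blast
  qed
qed

text \<open>Multiplying by \<open>x_i^2\<close> scales a moment by its exponent of
  \<open>x_i\<close> plus 1. Summing over the \<open>d + 1\<close> variables gives the degree plus
  \<open>d + 1\<close>.\<close>

lemma radial_moment:
  assumes a: "a \<in> multi_indices d m"
  shows "(\<Sum>c\<in>multi_indices d (l + 2). index_moment d (a + c) * radial d h c) =
    of_nat (d + 1 + m + l) * (\<Sum>c\<in>multi_indices d l. index_moment d (a + c) * h c)"
proof -
  let ?M = "multi_indices d" and ?L = Poly_Mapping.lookup
  have swap: "(\<Sum>c\<in>?M (l + 2). index_moment d (a + c) * shift i 2 h c) =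
      (\<Sum>c\<in>?M l. index_moment d (a + c + Poly_Mapping.single i 2) * h c)" if i: "i \<le> d" for i
  proof -
    let ?s = "Poly_Mapping.single i 2 :: nat \<Rightarrow>\<^sub>0 nat"
    have "(\<Sum>c\<in>?M (l + 2). index_moment d (a + c) * shift i 2 h c) =
        (\<Sum>c | c \<in> ?M (l + 2) \<and> 2 \<le> ?L c i. index_moment d (a + c) * h (c - ?s))"
      by (rule sum.mono_neutral_cong_right) (auto simp: finite_multi_indices shift_def)
    also have "\<dots> = (\<Sum>c\<in>?M l. index_moment d (a + c + ?s) * h c)"
    proof (rule sum.reindex_bij_witness[where i = "\<lambda>c. c + ?s" and j = "\<lambda>c. c - ?s"])
      fix c assume "c \<in> {c. c \<in> ?M (l + 2) \<and> 2 \<le> ?L c i}"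
      then have c: "c \<in> ?M (l + 2)" "2 \<le> ?L c i" by auto
      show "c - ?s + ?s = c" using c(2) by (rule minus_single_add)
      then show "index_moment d (a + (c - ?s) + ?s) * h (c - ?s) = index_moment d (a + c) * h (c - ?s)"
        by (simp add: add.assoc)
      show "c - ?s \<in> ?M l" using multi_indices_diff[OF c(1) i c(2)] by simp
    next
      fix c assume "c \<in> ?M l"
      then show "c + ?s \<in> {c. c \<in> ?M (l + 2) \<and> 2 \<le> ?L c i}"
        using multi_indices_add[OF _ i, of c l 2] by (simp add: lookup_add)
    qed simp
    finally show ?thesis .
  qed
  have "(\<Sum>c\<in>?M (l + 2). index_moment d (a + c) * radial d h c) =
      (\<Sum>i\<le>d. \<Sum>c\<in>?M (l + 2). index_moment d (a + c) * shift i 2 h c)"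
    by (subst sum.swap) (simp add: radial_def sum_distrib_left)
  also have "\<dots> = (\<Sum>i\<le>d. \<Sum>c\<in>?M l. of_nat (?L (a + c) i + 1) * (index_moment d (a + c) * h c))"
  proof (rule sum.cong[OF refl])
    fix i assume "i \<in> {..d}"
    then have i: "i \<le> d" by simp
    show "(\<Sum>c\<in>?M (l + 2). index_moment d (a + c) * shift i 2 h c) =
        (\<Sum>c\<in>?M l. of_nat (?L (a + c) i + 1) * (index_moment d (a + c) * h c))"
      unfolding swap[OF i] index_moment_add_2[OF i] by (simp only: mult.assoc)
  qed
  also have "\<dots> = (\<Sum>c\<in>?M l. of_nat (\<Sum>i\<le>d. ?L (a + c) i + 1) * (index_moment d (a + c) * h c))"
    by (subst sum.swap) (simp only: of_nat_sum sum_distrib_right)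
  also have "\<dots> = (\<Sum>c\<in>?M l. of_nat (d + 1 + m + l) * (index_moment d (a + c) * h c))"
  proof (rule sum.cong[OF refl])
    fix c assume c: "c \<in> ?M l"
    have "(\<Sum>i\<le>d. ?L (a + c) i + 1) = (\<Sum>i\<le>d. ?L a i) + (\<Sum>i\<le>d. ?L c i) + (d + 1)"
      by (simp only: lookup_add sum.distrib) simp
    then have "(\<Sum>i\<le>d. ?L (a + c) i + 1) = d + 1 + m + l"
      using a c by (simp add: multi_indices_def)
    then show "of_nat (\<Sum>i\<le>d. ?L (a + c) i + 1) * (index_moment d (a + c) * h c) =
        of_nat (d + 1 + m + l) * (index_moment d (a + c) * h c)" by simp
  qed
  finally show ?thesis by (simp add: sum_distrib_left)
qed

lemma radial_pow_moment_sum: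
  assumes a: "a \<in> multi_indices d m"
  shows "(\<Sum>c\<in>multi_indices d (l + 2 * j). index_moment d (a + c) * (radial d ^^ j) h c) =
    (\<Prod>i<j. of_nat (d + 1 + m + l + 2 * i)) * (\<Sum>c\<in>multi_indices d l. index_moment d (a + c) * h c)"
proof (induction j)
  case (Suc j)
  show ?case
    using radial_moment[OF a, where l = "l + 2 * j" and h = "(radial d ^^ j) h"] Suc
    by (simp add: algebra_simps)
qed simp

section \<open>The Gaussian moment matrix\<close>

text \<open>
  The basis \<open>r\<^bsup>2j\<^esup>x\<^sup>g\<close> with \<open>g\<^sub>0 \<le> 1\<close>, indexed by \<open>b = g + 2j e\<^sub>0\<close>. It is unitriangular over the
  monomials when these are ordered by their exponent of \<open>x\<^sub>0\<close>.
\<close>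

definition adapted :: "nat \<Rightarrow> (nat \<Rightarrow>\<^sub>0 nat) \<Rightarrow> (nat \<Rightarrow>\<^sub>0 nat) \<Rightarrow> rat" where
  "adapted d b = (radial d ^^ (Poly_Mapping.lookup b 0 div 2))
     (unit_coeff (b - Poly_Mapping.single 0 (2 * (Poly_Mapping.lookup b 0 div 2))))"

text \<open>Only the summand \<open>x_0^2\<close> of \<open>r^2\<close> raises the exponent of
  \<open>x_0\<close>, so its maximum is attained by a single monomial, with coefficient 1.\<close>

lemma radial_pow_unit_coeff_top:
  assumes "Poly_Mapping.lookup g 0 + 2 * j \<le> Poly_Mapping.lookup a 0"
  shows "(radial d ^^ j) (unit_coeff g) a = of_bool (a = g + Poly_Mapping.single 0 (2 * j))"
  using assms
proof (induction j arbitrary: a)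
  case (Suc j)
  let ?f = "(radial d ^^ j) (unit_coeff g)"
  let ?L = Poly_Mapping.lookup
  have other: "shift i 2 ?f a = 0" if "i \<noteq> 0" for i
  proof (cases "2 \<le> ?L a i")
    case True
    let ?b = "a - Poly_Mapping.single i 2"
    have b: "?L ?b 0 = ?L a 0" using that by (simp add: lookup_minus lookup_single)
    then have "?f ?b = of_bool (?b = g + Poly_Mapping.single 0 (2 * j))"
      using Suc.prems by (intro Suc.IH) simp
    moreover have "?L ?b 0 \<noteq> ?L (g + Poly_Mapping.single 0 (2 * j)) 0"
      using Suc.prems unfolding b by (simp add: lookup_add)
    then have "?b \<noteq> g + Poly_Mapping.single 0 (2 * j)" by metis
    ultimately show ?thesis by (simp add: shift_def)
  qed (simp add: shift_def)
  have "radial d ?f a = shift 0 2 ?f a"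
    unfolding radial_def[of d ?f a] using other by (subst sum.remove[of _ 0]) auto
  also have "\<dots> = of_bool (a = g + Poly_Mapping.single 0 (2 * Suc j))"
  proof -
    have le: "2 \<le> ?L a 0" using Suc.prems by simp
    have "?f (a - Poly_Mapping.single 0 2) =
        of_bool (a - Poly_Mapping.single 0 2 = g + Poly_Mapping.single 0 (2 * j))"
      using Suc.prems by (intro Suc.IH) (simp add: lookup_minus del: single_numeral)
    moreover have "g + Poly_Mapping.single 0 (2 * Suc j) =
        g + Poly_Mapping.single 0 (2 * j) + Poly_Mapping.single 0 2"
      by (simp add: add.assoc single_add[symmetric] del: single_numeral)
    ultimately show ?thesis
      using le minus_single_add[OF le] by (auto simp: shift_def)
  qed
  finally show ?case by simp
qed simp

lemma lookup_le_degree: "a \<in> multi_indices d k \<Longrightarrow> i \<le> d \<Longrightarrow> Poly_Mapping.lookup a i \<le> k"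
  using member_le_sum[of i "{..d}" "Poly_Mapping.lookup a"] by (auto simp: multi_indices_def)

lemma adapted_top:
  assumes "Poly_Mapping.lookup b 0 \<le> Poly_Mapping.lookup a 0"
  shows "adapted d b a = of_bool (a = b)"
  unfolding adapted_def using assms
  by (subst radial_pow_unit_coeff_top) (simp_all add: lookup_minus minus_single_add)

lemma det_adapted:
  assumes "distinct l" "set l = multi_indices d k"
  shows "det (gram_matrix (\<lambda>a b. adapted d b a) l) = 1"
proof -
  have "det (gram_matrix (\<lambda>a b. adapted d b a) l) = (\<Prod>a\<in>set l. adapted d a a)"
  proof (rule det_gram_triangular[OF assms(1), where key = "\<lambda>a. k - Poly_Mapping.lookup a 0"])
    fix a b assume ab: "a \<in> set l" "b \<in> set l" "adapted d b a \<noteq> 0"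
    then have "Poly_Mapping.lookup b 0 \<le> k" using assms(2) lookup_le_degree by auto
    then show "a = b \<or> k - Poly_Mapping.lookup b 0 < k - Poly_Mapping.lookup a 0"
      using ab(3) adapted_top[of b a d] by (cases "Poly_Mapping.lookup b 0 \<le> Poly_Mapping.lookup a 0") auto
  qed
  then show ?thesis by (simp add: adapted_top)
qed

lemma radial_pow_adapted:
  "(radial d ^^ i) (adapted d b) = adapted d (b + Poly_Mapping.single 0 (2 * i))"
proof -
  let ?q = "Poly_Mapping.lookup b 0 div 2"
  have "b + Poly_Mapping.single 0 (2 * i) - Poly_Mapping.single 0 (2 * (?q + i)) =
      b - Poly_Mapping.single 0 (2 * ?q)"
    by (rule poly_mapping_eqI) (auto simp: lookup_add lookup_minus lookup_single when_def)
  moreover have "Poly_Mapping.lookup (b + Poly_Mapping.single 0 (2 * i)) 0 div 2 = ?q + i"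
    by (simp add: lookup_add)
  ultimately show ?thesis
    by (simp add: adapted_def funpow_add[symmetric, THEN fun_cong, simplified] add.commute)
qed

lemma adapted_expansion:
  "\<exists>c. \<forall>a\<in>multi_indices d k. u a = (\<Sum>b\<in>multi_indices d k. c b * adapted d b a)"
proof -
  obtain l where l: "set l = multi_indices d k" "distinct l"
    using finite_distinct_list[OF finite_multi_indices] by blast
  show ?thesis
    using gram_matrix_solve[OF l(2) det_adapted[OF l(2,1)], of u] by (simp add: l(1) mult.commute)
qed

text \<open>Multiplication by \<open>r^(2i)\<close> merely adds \<open>2i\<close> to the zeroth
  entry of a basis index, so the filtration by powers of \<open>r^2\<close> is spanned by basis
  elements. If \<open>2i\<close> exceeds the degree, everything is 0.\<close>

lemma radial_pow_expansion:
  "\<exists>c. (\<forall>a\<in>multi_indices d k. (radial d ^^ i) u a = (\<Sum>b\<in>multi_indices d k. c b * adapted d b a)) \<and>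
    (\<forall>b. c b \<noteq> 0 \<longrightarrow> 2 * i \<le> Poly_Mapping.lookup b 0)"
proof (cases "2 * i \<le> k")
  case False
  then show ?thesis using radial_pow_eq_0 by (intro exI[of _ "\<lambda>_. 0"]) auto
next
  case True
  let ?M = "multi_indices d" and ?L = Poly_Mapping.lookup
  let ?s = "Poly_Mapping.single 0 (2 * i) :: nat \<Rightarrow>\<^sub>0 nat"
  obtain c where c: "\<And>a. a \<in> ?M (k - 2 * i) \<Longrightarrow> u a = (\<Sum>b\<in>?M (k - 2 * i). c b * adapted d b a)"
    using adapted_expansion by metis
  define c' where "c' b = (if 2 * i \<le> ?L b 0 then c (b - ?s) else 0)" for b
  have "(radial d ^^ i) u a = (\<Sum>b\<in>?M k. c' b * adapted d b a)" if a: "a \<in> ?M k" for a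
  proof -
    have "(radial d ^^ i) u a = (radial d ^^ i) (\<lambda>a. \<Sum>b\<in>?M (k - 2 * i). c b * adapted d b a) a"
      using a True by (intro radial_pow_cong[OF c]) auto
    also have "\<dots> = (\<Sum>b\<in>?M (k - 2 * i). c b * adapted d (b + ?s) a)"
      by (simp add: radial_pow_linear radial_pow_adapted)
    also have "\<dots> = (\<Sum>b | b \<in> ?M k \<and> 2 * i \<le> ?L b 0. c (b - ?s) * adapted d b a)"
    proof (rule sum.reindex_bij_witness[where j = "\<lambda>b. b + ?s" and i = "\<lambda>b. b - ?s"])
      fix b assume "b \<in> ?M (k - 2 * i)"
      then show "b + ?s \<in> {b. b \<in> ?M k \<and> 2 * i \<le> ?L b 0}"
        using multi_indices_add[of b d "k - 2 * i" 0 "2 * i"] True by (simp add: lookup_add)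
    next
      fix b assume b: "b \<in> {b. b \<in> ?M k \<and> 2 * i \<le> ?L b 0}"
      then show "b - ?s + ?s = b" by (intro minus_single_add) simp
      show "b - ?s \<in> ?M (k - 2 * i)"
        using b multi_indices_diff[of b d k 0 "2 * i"] by simp
    qed auto
    also have "\<dots> = (\<Sum>b\<in>?M k. c' b * adapted d b a)"
      by (rule sum.mono_neutral_cong_left) (auto simp: finite_multi_indices c'_def)
    finally show ?thesis .
  qed
  then show ?thesis by (intro exI[of _ c']) (auto simp: c'_def)
qed

definition radial_ratio :: "nat \<Rightarrow> nat \<Rightarrow> nat \<Rightarrow> rat" where
  "radial_ratio d k i = of_nat (2 * k + d + 1 - 2 * i) / of_nat (2 * i)"

text \<open>
  Relative to the adapted basis and the inner product \<open>\<langle>_, _\<rangle>\<close>, the Gaussian form is triangular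
  for the filtration by powers of \<open>r\<^sup>2\<close>, and it acts on each graded piece as a scalar.
\<close>

lemma moment_adapted:
  assumes b: "b \<in> multi_indices d k"
  shows "\<exists>U. (\<forall>a\<in>multi_indices d k.
      (\<Sum>c\<in>multi_indices d k. index_moment d (a + c) * adapted d b c) =
      index_fact d a * (\<Sum>c\<in>multi_indices d k. adapted d c a * U c)) \<and>
    U b = (\<Prod>i=1..Poly_Mapping.lookup b 0 div 2. radial_ratio d k i) \<and>
    (\<forall>c. U c \<noteq> 0 \<longrightarrow> c = b \<or> Poly_Mapping.lookup b 0 div 2 < Poly_Mapping.lookup c 0 div 2)"
proof -
  let ?M = "multi_indices d" and ?L = Poly_Mapping.lookup
  define j where "j = ?L b 0 div 2"
  define g where "g = b - Poly_Mapping.single 0 (2 * j)"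
  define m where "m = k - 2 * j"
  have g: "g \<in> ?M m" and k: "k = m + 2 * j"
    using multi_indices_diff[OF b, of 0 "2 * j"] by (auto simp: g_def m_def j_def)
  have bas: "adapted d b = (radial d ^^ j) (unit_coeff g)"
    by (simp add: adapted_def g_def j_def)
  define E :: rat where "E = (\<Prod>i<j. of_nat (d + 1 + k + m + 2 * i))"
  obtain u where u: "\<And>a. a \<in> ?M k \<Longrightarrow> index_moment d (a + g) =
      index_fact d a * (adapted d b a / (2 ^ j * fact j) + (radial d ^^ Suc j) u a)"
    using index_moment_expansion[OF g, of j] unfolding bas k by blast
  obtain c where c: "\<And>a. a \<in> ?M k \<Longrightarrow> (radial d ^^ Suc j) u a = (\<Sum>e\<in>?M k. c e * adapted d e a)"
    "\<And>e. c e \<noteq> 0 \<Longrightarrow> 2 * Suc j \<le> ?L e 0"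
    using radial_pow_expansion[of d k "Suc j" u] by blast
  define U where "U e = (if e = b then E / (2 ^ j * fact j) else 0) + E * c e" for e
  \<comment> \<open>The remainder lies one step deeper in the filtration than \<open>b\<close>, so
    it does not disturb the diagonal entry.\<close>
  have "\<not> 2 * Suc j \<le> ?L b 0" unfolding j_def by presburger
  then have cb: "c b = 0" using c(2)[of b] by blast
  \<comment> \<open>As \<open>m = k - 2j\<close>, the factor of \<open>E\<close> with index
    \<open>j - i\<close> is \<open>2k + d + 1 - 2i\<close>.\<close>
  have E: "E / (2 ^ j * fact j) = (\<Prod>i=1..j. radial_ratio d k i)"
  proof -
    have "E = (\<Prod>i=1..j. of_nat (2 * k + d + 1 - 2 * i))"
      unfolding E_def
      by (rule prod.reindex_bij_witness[where i = "\<lambda>i. j - i" and j = "\<lambda>i. j - i"])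
        (auto simp: k)
    moreover have "(\<Prod>i=1..j. of_nat (2 * i)) = (2 ^ j * fact j :: rat)"
      by (simp add: prod.distrib fact_prod)
    ultimately show ?thesis by (simp add: radial_ratio_def prod_dividef)
  qed
  have "(\<Sum>c\<in>?M k. index_moment d (a + c) * adapted d b c) =
      index_fact d a * (\<Sum>e\<in>?M k. adapted d e a * U e)" if a: "a \<in> ?M k" for a
  proof -
    have "(\<Sum>c\<in>?M k. index_moment d (a + c) * adapted d b c) =
        E * (\<Sum>c\<in>?M m. index_moment d (a + c) * unit_coeff g c)"
      unfolding bas E_def using radial_pow_moment_sum[OF a, where l = m and j = j] by (simp only: k)
    also have "(\<Sum>c\<in>?M m. index_moment d (a + c) * unit_coeff g c) = index_moment d (a + g)"
      using g by (simp add: finite_multi_indices of_bool_def if_distrib cong: if_cong)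
    also have "E * index_moment d (a + g) = index_fact d a *
        (adapted d b a * (E / (2 ^ j * fact j)) + (\<Sum>e\<in>?M k. adapted d e a * (E * c e)))"
      unfolding u[OF a] c(1)[OF a] by (simp add: algebra_simps sum_distrib_left)
    also have "adapted d b a * (E / (2 ^ j * fact j)) =
        (\<Sum>e\<in>?M k. adapted d e a * (if e = b then E / (2 ^ j * fact j) else 0))"
      using b by (simp add: finite_multi_indices if_distrib cong: if_cong)
    finally show ?thesis by (simp add: U_def distrib_left sum.distrib)
  qed
  moreover have "U b = (\<Prod>i=1..j. radial_ratio d k i)"
    by (simp add: U_def cb E)
  moreover have "e = b \<or> j < ?L e 0 div 2" if "U e \<noteq> 0" for e
    using that c(2)[of e] by (auto simp: U_def split: if_splits)
  ultimately show ?thesis unfolding j_def by (intro exI[of _ U]) blast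
qed

text \<open>In matrix form \<open>M P = F P U\<close>, with \<open>M\<close> the moments,
  \<open>P\<close> the adapted basis of determinant 1, \<open>F\<close> the diagonal matrix of
  factorials and \<open>U\<close> triangular with products of \<open>radial_ratio\<close> on the
  diagonal.\<close>

lemma det_index_moment:
  assumes "distinct l" "set l = multi_indices d k"
  shows "det (gram_matrix (\<lambda>a b. index_moment d (a + b)) l) =
    (\<Prod>a\<in>multi_indices d k. index_fact d a) *
    (\<Prod>a\<in>multi_indices d k. \<Prod>i=1..Poly_Mapping.lookup a 0 div 2. radial_ratio d k i)"
proof -
  let ?M = "multi_indices d k" and ?L = Poly_Mapping.lookup
  define P where "P b V \<longleftrightarrow> (\<forall>a\<in>?M.
      (\<Sum>c\<in>?M. index_moment d (a + c) * adapted d b c) =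
      index_fact d a * (\<Sum>c\<in>?M. adapted d c a * V c)) \<and>
    V b = (\<Prod>i=1..?L b 0 div 2. radial_ratio d k i) \<and>
    (\<forall>c. V c \<noteq> 0 \<longrightarrow> c = b \<or> ?L b 0 div 2 < ?L c 0 div 2)" for b V
  have "\<forall>b\<in>?M. \<exists>V. P b V"
    unfolding P_def using moment_adapted by blast
  then obtain U where "\<forall>b\<in>?M. P b (U b)" by metis
  then have U: "\<And>a b. a \<in> ?M \<Longrightarrow> b \<in> ?M \<Longrightarrow>
      (\<Sum>c\<in>?M. index_moment d (a + c) * adapted d b c) =
      index_fact d a * (\<Sum>c\<in>?M. adapted d c a * U b c)"
    "\<And>b. b \<in> ?M \<Longrightarrow> U b b = (\<Prod>i=1..?L b 0 div 2. radial_ratio d k i)"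
    "\<And>b c. b \<in> ?M \<Longrightarrow> U b c \<noteq> 0 \<Longrightarrow> c = b \<or> ?L b 0 div 2 < ?L c 0 div 2"
    unfolding P_def by blast+
  have "det (gram_matrix (\<lambda>a b. index_moment d (a + b)) l) =
      det (gram_matrix (\<lambda>a b. \<Sum>c\<in>set l. index_moment d (a + c) * adapted d b c) l)"
    using det_gram_mult[OF assms(1), of "\<lambda>a b. index_moment d (a + b)" "\<lambda>a b. adapted d b a"]
    by (simp add: det_adapted[OF assms])
  also have "\<dots> = det (gram_matrix (\<lambda>a b. index_fact d a * (\<Sum>c\<in>set l. adapted d c a * U b c)) l)"
    by (intro arg_cong[of _ _ det] gram_matrix_cong) (simp add: assms(2) U(1))
  also have "\<dots> = (\<Prod>a\<in>set l. index_fact d a) * det (gram_matrix (\<lambda>a b. U b a) l)"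
    using det_gram_mult[OF assms(1), of "\<lambda>a b. adapted d b a" "\<lambda>a b. U b a"]
    by (simp add: det_gram_scale_rows[OF assms(1)] det_adapted[OF assms])
  also have "det (gram_matrix (\<lambda>a b. U b a) l) = (\<Prod>a\<in>set l. U a a)"
    using U(3) assms(2)
    by (intro det_gram_triangular[OF assms(1), where key = "\<lambda>a. ?L a 0 div 2"]) auto
  finally show ?thesis by (simp add: assms(2) U(2))
qed

section \<open>Matching the exponents with those of \<open>theta\<close>\<close>

lemma prod_index_fact:
  "(\<Prod>a\<in>multi_indices d k. index_fact d a) =
    (\<Prod>j=1..k. of_nat j ^ ((d + 1) * ((k - j + d) choose d)))"
proof -
  have "(\<Prod>a\<in>multi_indices d k. index_fact d a) =
      (\<Prod>i\<le>d. \<Prod>a\<in>multi_indices d k. \<Prod>j=1..Poly_Mapping.lookup a i div 1. of_nat j)"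
    unfolding index_fact_def by (subst prod.swap) (simp add: fact_prod)
  also have "\<dots> = (\<Prod>i\<le>d. \<Prod>j=1..k. of_nat j ^ ((k - j + d) choose d))"
  proof (rule prod.cong[OF refl])
    fix i assume "i \<in> {..d}"
    then show "(\<Prod>a\<in>multi_indices d k. \<Prod>j=1..Poly_Mapping.lookup a i div 1. of_nat j) =
        (\<Prod>j=1..k. (of_nat j :: rat) ^ ((k - j + d) choose d))"
      using prod_multi_indices[of i d 1 "of_nat :: nat \<Rightarrow> rat" k] by simp
  qed
  also have "\<dots> = (\<Prod>j=1..k. of_nat j ^ ((d + 1) * ((k - j + d) choose d)))"
    by (simp add: prod_power_distrib power_mult[symmetric] power_add prod.distrib ac_simps)
  finally show ?thesis .
qed

text \<open>For \<open>k < i \<le> k + d\<close> both sides are 0; beyond that range the upper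
  argument is negative and is reflected.\<close>

lemma ichoose_cases:
  "(int k - int i + int d) ichoose d =
    (if i \<le> k then int ((k - i + d) choose d) else (- 1) ^ d * int ((i - k - 1) choose d))"
proof (cases "i \<le> k")
  case True
  then have "nat (int k - int i + int d) = k - i + d" by simp
  then show ?thesis using True by (simp add: ichoose_nonneg)
next
  case False
  then have "nat (int d - (int k - int i + int d) - 1) = i - k - 1" by simp
  then show ?thesis
    using False by (simp add: ichoose_negated_upper[of "int k - int i + int d"] ichoose_nonneg)
qed

text \<open>The denominators \<open>2i\<close> cancel exactly the even factors
  \<open>j = 2i\<close>, which carry the same exponent, leaving the odd \<open>j \<le> k\<close>.
  The numerators run through the odd numbers above \<open>k + d\<close> that have nonzero position
  in \<open>theta\<close>, up to \<open>2k + d - 1\<close>; in the gap between \<open>k\<close> and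
  \<open>k + d\<close> the exponents are 0.\<close>

lemma theta_factor_even:
  assumes "even d"
  shows "(\<Prod>j=1..k. of_nat j ^ ((k - j + d) choose d)) *
      (\<Prod>i=1..k div 2. radial_ratio d k i ^ ((k - 2 * i + d) choose d)) =
    of_int (\<Prod>i | 1 \<le> i \<and> i \<le> 2 * k + d - 1 \<and> odd i. int i ^ nat ((int k - int i + int d) ichoose d))"
proof -
  let ?e = "\<lambda>i. nat ((int k - int i + int d) ichoose d)"
  let ?c = "\<lambda>j. (k - j + d) choose d"
  let ?t = "\<lambda>i. of_nat i ^ ?e i :: rat"
  let ?n = "\<lambda>i. 2 * k + d + 1 - 2 * i"
  have e_low: "?e i = ?c i" if "i \<le> k" for i
    using that by (simp add: ichoose_cases)
  have e_high: "?e i = (i - k - 1) choose d" if "k < i" for i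
    using that assms by (simp add: ichoose_cases)
  let ?O = "{i. 1 \<le> i \<and> i \<le> 2 * k + d - 1 \<and> odd i}"
  let ?A = "{i. i \<in> {1..k} \<and> odd i}" and ?B = "{i. i \<in> {1..k} \<and> even i}"
  let ?H = "{i. k + d < i \<and> i \<le> 2 * k + d - 1 \<and> odd i}"
  have "(\<Prod>i\<in>?O. ?t i) = (\<Prod>i\<in>?A \<union> ?H. ?t i)"
  proof (rule prod.mono_neutral_right)
    show "\<forall>i\<in>?O - (?A \<union> ?H). ?t i = 1"
    proof
      fix i assume "i \<in> ?O - (?A \<union> ?H)"
      then have "k < i" "i - k - 1 < d" by auto
      then show "?t i = 1" using e_high[of i] by (simp add: binomial_eq_0)
    qed
  qed auto
  also have "\<dots> = (\<Prod>i\<in>?A. ?t i) * (\<Prod>i\<in>?H. ?t i)"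
    by (rule prod.union_disjoint) auto
  also have "(\<Prod>i\<in>?H. ?t i) = (\<Prod>i=1..k div 2. of_nat (?n i) ^ ?c (2 * i))"
  proof (rule prod.reindex_bij_witness[where i = ?n and j = "\<lambda>i. (2 * k + d + 1 - i) div 2"])
    fix i assume i: "i \<in> ?H"
    let ?j = "(2 * k + d + 1 - i) div 2"
    have "even (2 * k + d + 1 - i)" using i assms by auto
    then have j: "2 * ?j = 2 * k + d + 1 - i" by simp
    then show ij: "?n ?j = i" using i by auto
    show "?j \<in> {1..k div 2}" using i j by auto
    have eq: "i - k - 1 = k - 2 * ?j + d" and ki: "k < i" using i j by auto
    show "of_nat (?n ?j) ^ ?c (2 * ?j) = ?t i"
      by (simp only: ij e_high[OF ki] eq)
  next
    fix j assume j: "j \<in> {1..k div 2}"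
    then have j2: "2 * j \<le> k" "1 \<le> j" by auto
    show "?n j \<in> ?H" using j2 assms by auto
    show "(2 * k + d + 1 - ?n j) div 2 = j" using j2 by simp
  qed
  finally have odd_part: "(\<Prod>i\<in>?O. ?t i) =
      (\<Prod>i\<in>?A. ?t i) * (\<Prod>i=1..k div 2. of_nat (?n i) ^ ?c (2 * i))" .
  have "(\<Prod>j=1..k. of_nat j ^ ?c j) = (\<Prod>j\<in>?A \<union> ?B. of_nat j ^ ?c j :: rat)"
    by (rule prod.cong) auto
  also have "\<dots> = (\<Prod>j\<in>?A. of_nat j ^ ?c j) * (\<Prod>j\<in>?B. of_nat j ^ ?c j)"
    by (rule prod.union_disjoint) auto
  also have "(\<Prod>j\<in>?A. of_nat j ^ ?c j) = (\<Prod>i\<in>?A. ?t i)"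
    by (rule prod.cong) (auto simp: e_low)
  also have "(\<Prod>j\<in>?B. of_nat j ^ ?c j) = (\<Prod>i=1..k div 2. of_nat (2 * i) ^ ?c (2 * i) :: rat)"
    by (rule prod.reindex_bij_witness[where i = "\<lambda>i. 2 * i" and j = "\<lambda>i. i div 2"]) auto
  finally have "(\<Prod>j=1..k. of_nat j ^ ?c j) =
      (\<Prod>i\<in>?A. ?t i) * (\<Prod>i=1..k div 2. of_nat (2 * i) ^ ?c (2 * i))" .
  moreover have "(\<Prod>i=1..k div 2. of_nat (2 * i) ^ ?c (2 * i)) *
      (\<Prod>i=1..k div 2. radial_ratio d k i ^ ?c (2 * i)) =
      (\<Prod>i=1..k div 2. of_nat (?n i) ^ ?c (2 * i))"
    unfolding prod.distrib[symmetric] power_mult_distrib[symmetric]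
    by (rule prod.cong) (auto simp: radial_ratio_def)
  ultimately show ?thesis
    using odd_part by (simp add: mult.assoc)
qed

text \<open>With \<open>d = 2h + 1\<close> each scalar reduces to
  \<open>(k + h + 1 - i) / i\<close>. Its denominators are moved to the other side, so that
  exponents are compared by addition in \<open>nat\<close>.\<close>

lemma theta_factor_odd:
  assumes "odd d"
  shows "(\<Prod>j=1..k. of_nat j ^ ((k - j + d) choose d)) *
      (\<Prod>i=1..k div 2. radial_ratio d k i ^ ((k - 2 * i + d) choose d)) =
    of_int (\<Prod>i=1..k + (d - 1) div 2. int i ^ nat (((int k - int i + int d) ichoose d) -
      ((int k - 2 * int i + int d) ichoose d)))"
proof -
  obtain h where d: "d = 2 * h + 1" using assms by (auto elim: oddE)
  let ?N = "{1..k + h}"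
  let ?c = "\<lambda>j. (k - j + d) choose d"
  let ?E = "\<lambda>i. nat (((int k - int i + int d) ichoose d) - ((int k - 2 * int i + int d) ichoose d))"
  \<comment> \<open>Exponents of \<open>i\<close> over the common range: \<open>p\<close> from the
    denominators, \<open>q\<close> from the factorial part, \<open>r\<close> from the numerators. As
    \<open>d\<close> is odd, reflecting a negative upper argument gives \<open>- r\<close>, so the
    second binomial of \<open>theta\<close> is \<open>p - r\<close>.\<close>
  define p where "p i = (if 2 * i \<le> k then ?c (2 * i) else 0)" for i
  define q where "q i = (if i \<le> k then ?c i else 0)" for i
  define r where "r i = (if k < 2 * i then (2 * i - k - 1) choose d else 0)" for i
  have exps: "?E i + p i = q i + r i" if i: "i \<in> ?N" for i
  proof -
    have "int (?E i) = ((int k - int i + int d) ichoose d) - ((int k - 2 * int i + int d) ichoose d)"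
      using theta_exponent_odd[OF assms, of i k] i by (simp add: d)
    moreover have "((int k - int i + int d) ichoose d) = int (q i)"
    proof -
      have "i - k - 1 < d" using i by (auto simp: d)
      then show ?thesis by (simp add: ichoose_cases q_def binomial_eq_0)
    qed
    moreover have "((int k - 2 * int i + int d) ichoose d) = int (p i) - int (r i)"
      using ichoose_cases[of k "2 * i" d] assms by (simp add: p_def r_def)
    ultimately show ?thesis by linarith
  qed
  have P: "(\<Prod>i\<in>?N. of_nat i ^ p i) = (\<Prod>i=1..k div 2. of_nat i ^ ?c (2 * i) :: rat)"
    by (rule prod.mono_neutral_cong_right) (auto simp: p_def)
  have Q: "(\<Prod>i\<in>?N. of_nat i ^ q i) = (\<Prod>i=1..k. of_nat i ^ ?c i :: rat)"
    by (rule prod.mono_neutral_cong_right) (auto simp: q_def)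
  have R: "(\<Prod>i\<in>?N. of_nat i ^ r i) = (\<Prod>i=1..k div 2. of_nat (k + h + 1 - i) ^ ?c (2 * i) :: rat)"
  proof -
    have "(\<Prod>i\<in>?N. of_nat i ^ r i) = (\<Prod>i | i \<in> ?N \<and> k + d < 2 * i. of_nat i ^ r i :: rat)"
    proof (rule prod.mono_neutral_right)
      show "\<forall>i\<in>?N - {i. i \<in> ?N \<and> k + d < 2 * i}. of_nat i ^ r i = (1::rat)"
      proof
        fix i assume "i \<in> ?N - {i. i \<in> ?N \<and> k + d < 2 * i}"
        then have "r i = 0" by (auto simp: r_def d intro!: binomial_eq_0)
        then show "of_nat i ^ r i = (1::rat)" by simp
      qed
    qed auto
    also have "\<dots> = (\<Prod>i=1..k div 2. of_nat (k + h + 1 - i) ^ ?c (2 * i))"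
    proof (rule prod.reindex_bij_witness[where i = "\<lambda>i. k + h + 1 - i" and j = "\<lambda>i. k + h + 1 - i"])
      fix i assume i: "i \<in> {i. i \<in> ?N \<and> k + d < 2 * i}"
      then have "k - 2 * (k + h + 1 - i) + d = 2 * i - k - 1" by (auto simp: d)
      then show "of_nat (k + h + 1 - (k + h + 1 - i)) ^ ?c (2 * (k + h + 1 - i)) = (of_nat i ^ r i :: rat)"
        using i by (simp add: r_def)
    qed (auto simp: d)
    finally show ?thesis .
  qed
  have nz: "(\<Prod>i=1..k div 2. of_nat i ^ ?c (2 * i) :: rat) \<noteq> 0" by auto
  have ratio: "(\<Prod>i=1..k div 2. of_nat i ^ ?c (2 * i)) *
      (\<Prod>i=1..k div 2. radial_ratio d k i ^ ?c (2 * i)) =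
      (\<Prod>i=1..k div 2. of_nat (k + h + 1 - i) ^ ?c (2 * i))"
    unfolding prod.distrib[symmetric] power_mult_distrib[symmetric]
  proof (rule prod.cong[OF refl])
    fix i assume i: "i \<in> {1..k div 2}"
    then have "2 * k + d + 1 - 2 * i = 2 * (k + h + 1 - i)" by (auto simp: d)
    then have "of_nat i * radial_ratio d k i = of_nat (k + h + 1 - i)"
      using i by (simp add: radial_ratio_def)
    then show "(of_nat i * radial_ratio d k i) ^ ?c (2 * i) = of_nat (k + h + 1 - i) ^ ?c (2 * i)"
      by simp
  qed
  have "(\<Prod>i\<in>?N. of_nat i ^ ?E i) * (\<Prod>i\<in>?N. of_nat i ^ p i) =
      (\<Prod>i\<in>?N. of_nat i ^ q i) * (\<Prod>i\<in>?N. of_nat i ^ r i :: rat)"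
    unfolding prod.distrib[symmetric] power_add[symmetric]
    by (rule prod.cong) (auto simp: exps simp del: atLeastAtMost_iff)
  then have "(\<Prod>i=1..k div 2. of_nat i ^ ?c (2 * i)) * (\<Prod>i\<in>?N. of_nat i ^ ?E i) =
      (\<Prod>i=1..k div 2. of_nat i ^ ?c (2 * i)) * ((\<Prod>i=1..k. of_nat i ^ ?c i) *
      (\<Prod>i=1..k div 2. radial_ratio d k i ^ ?c (2 * i)))"
    unfolding P Q R ratio[symmetric] by (simp only: ac_simps)
  then have "(\<Prod>i\<in>?N. of_nat i ^ ?E i) = (\<Prod>i=1..k. of_nat i ^ ?c i) *
      (\<Prod>i=1..k div 2. radial_ratio d k i ^ ?c (2 * i))"
    by (rule mult_left_cancel[OF nz, THEN iffD1])
  then show ?thesis by (simp add: d)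
qed

text \<open>Of the \<open>d + 1\<close> equal contributions of the variables to the factorials,
  \<open>d\<close> form the first product of \<open>theta\<close>; the last one combines with the
  scalars.\<close>

lemma det_index_moment_theta:
  assumes "distinct l" "set l = multi_indices d k"
  shows "det (gram_matrix (\<lambda>a b. index_moment d (a + b)) l) = of_int (theta d k)"
proof -
  let ?c = "\<lambda>j. (k - j + d) choose d"
  have "(\<Prod>a\<in>multi_indices d k. \<Prod>i=1..Poly_Mapping.lookup a 0 div 2. radial_ratio d k i) =
      (\<Prod>i=1..k div 2. radial_ratio d k i ^ ?c (2 * i))"
    by (rule prod_multi_indices) auto
  then have "det (gram_matrix (\<lambda>a b. index_moment d (a + b)) l) =
      (\<Prod>j=1..k. of_nat j ^ (d * ?c j)) * ((\<Prod>j=1..k. of_nat j ^ ?c j) *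
      (\<Prod>i=1..k div 2. radial_ratio d k i ^ ?c (2 * i)))"
    unfolding det_index_moment[OF assms] prod_index_fact
    by (simp add: power_add prod.distrib mult.assoc)
  moreover have "(\<Prod>j=1..k. of_nat j ^ (d * ?c j)) =
      (of_int (\<Prod>i=1..k. int i ^ nat (int d * ((int k - int i + int d) ichoose d))) :: rat)"
    by (simp only: of_int_prod, rule prod.cong) (auto simp: ichoose_cases nat_mult_distrib)
  ultimately show ?thesis
    unfolding theta_def using theta_factor_even[of d k] theta_factor_odd[of d k]
    by (simp only: of_int_mult split: if_split) simp
qed

section \<open>Reduction to diagonal forms\<close>

lemma (in comm_ring_hom) hom_pairing_sum:
  "hom (pairing_sum B w) = pairing_sum (\<lambda>i j. hom (B i j)) w"
  by (simp add: pairing_sum_def hom_sum hom_prod)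

lemma (in comm_ring_hom) hom_sym_gram:
  "hom (sym_gram G d a b) = sym_gram (\<lambda>i j. hom (G i j)) d a b"
  by (simp add: sym_gram_def hom_pairing_sum)

lemma (in comm_ring_hom) hom_det_gram:
  "hom (det (gram_matrix f l)) = det (gram_matrix (\<lambda>a b. hom (f a b)) l)"
proof -
  have "map_mat hom (gram_matrix f l) = gram_matrix (\<lambda>a b. hom (f a b)) l"
    by (intro eq_matI) auto
  then show ?thesis by (metis hom_det)
qed

lemma sym_gram_diagonal:
  assumes "a \<in> multi_indices d k" "b \<in> multi_indices d k"
  shows "sym_gram (\<lambda>i j. if i = j then D i else (0::'k::comm_ring_1)) d a b =
    of_int (\<Prod>i\<le>d. int (normal_moment (Poly_Mapping.lookup a i + Poly_Mapping.lookup b i))) *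
    (\<Prod>i\<le>d. D i ^ ((Poly_Mapping.lookup a i + Poly_Mapping.lookup b i) div 2))"
proof -
  have "set (index_word d a @ index_word d b) \<subseteq> {..d}"
    using assms index_word_in_words by (auto simp: words_def)
  from pairing_sum_diagonal[OF this, of D] show ?thesis
    by (simp add: sym_gram_def index_word_mset[OF assms(1)] index_word_mset[OF assms(2)]
        prod.distrib of_nat_prod flip: count_mset_0_iff)
qed

lemma det_sym_gram_diagonal:
  assumes "distinct l" "set l = multi_indices d k"
  shows "det (gram_matrix (sym_gram (\<lambda>i j. if i = j then D i else 0) d) l) =
    (\<Prod>i\<le>d. D i) ^ ((d + k) choose (d + 1)) * (of_int (theta d k) :: 'k::comm_ring_1)"
proof -
  let ?L = Poly_Mapping.lookup
  \<comment> \<open>An integer version of the moment matrix: its determinant is computed in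
    \<open>rat\<close>, pulled back by injectivity of \<open>of_int\<close>, and then mapped into
    the ring.\<close>
  define m where "m a b = (\<Prod>i\<le>d. int (normal_moment (?L a i + ?L b i)))" for a b
  have m0: "m a b = 0" if "i \<le> d" "odd (?L a i + ?L b i)" for a b i
    unfolding m_def using that by (intro prod_zero) (auto simp: normal_moment_odd intro!: bexI[of _ i])
  have "(of_int (det (gram_matrix m l)) :: rat) = det (gram_matrix (\<lambda>a b. of_int (m a b)) l)"
    by (rule of_int_hom.hom_det_gram)
  also have "(\<lambda>a b. of_int (m a b)) = (\<lambda>a b. index_moment d (a + b))"
    by (intro ext) (simp add: m_def index_moment_def lookup_add)
  finally have m: "det (gram_matrix m l) = theta d k"
    unfolding det_index_moment_theta[OF assms] by (simp only: of_int_eq_iff)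
  have "det (gram_matrix (sym_gram (\<lambda>i j. if i = j then D i else 0) d) l) =
      det (gram_matrix (\<lambda>a b. of_int (m a b) * (\<Prod>i\<le>d. D i ^ ((?L a i + ?L b i) div 2))) l)"
    unfolding m_def using assms(2)
    by (intro arg_cong[of _ _ det] gram_matrix_cong) (simp add: sym_gram_diagonal del: of_int_prod)
  also have "\<dots> = det (gram_matrix (\<lambda>a b. of_int (m a b)) l) * (\<Prod>i\<le>d. D i ^ (\<Sum>a\<in>set l. ?L a i))"
    by (rule det_gram_weights[OF assms(1)]) (simp add: m0)
  also have "det (gram_matrix (\<lambda>a b. of_int (m a b)) l) = (of_int (theta d k) :: 'k)"
    unfolding m[symmetric] by (rule of_int_hom.hom_det_gram[symmetric])
  also have "(\<Prod>i\<le>d. D i ^ (\<Sum>a\<in>set l. ?L a i)) = (\<Prod>i\<le>d. D i) ^ ((d + k) choose (d + 1))"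
    unfolding prod_power_distrib assms(2)
    by (rule prod.cong) (simp_all only: sum_lookup_multi_indices atMost_iff)
  finally show ?thesis by (simp add: mult.commute)
qed

text \<open>The symmetric power acts on both sides, hence the factor 2; in each determinant
  \<open>A i i\<close> occurs with the total exponent of \<open>x_i\<close> over all
  monomials.\<close>

lemma det_sym_gram_congruence:
  fixes A G :: "nat \<Rightarrow> nat \<Rightarrow> 'k::comm_ring_1"
  assumes l: "distinct l" "set l = multi_indices d k"
    and sym: "\<And>a b. a \<le> d \<Longrightarrow> b \<le> d \<Longrightarrow> G a b = G b a"
    and tri: "\<And>i j. i < j \<Longrightarrow> A i j = 0"
  shows "det (gram_matrix (sym_gram (\<lambda>i j. \<Sum>a\<le>d. \<Sum>b\<le>d. A i a * A j b * G a b) d) l) =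
    (\<Prod>i\<le>d. A i i) ^ (2 * ((d + k) choose (d + 1))) * det (gram_matrix (sym_gram G d) l)"
proof -
  let ?S = "sym_power A d" and ?g = "sym_gram G d"
  let ?N = "(d + k) choose (d + 1)"
  have "det (gram_matrix (sym_gram (\<lambda>i j. \<Sum>a\<le>d. \<Sum>b\<le>d. A i a * A j b * G a b) d) l) =
      det (gram_matrix (\<lambda>a b. \<Sum>c\<in>set l. ?S a c * (\<Sum>e\<in>set l. ?g c e * ?S b e)) l)"
  proof (intro arg_cong[of _ _ det] gram_matrix_cong)
    fix a b assume "a \<in> set l" "b \<in> set l"
    then have "a \<in> multi_indices d k" "b \<in> multi_indices d k" using l(2) by auto
    from sym_gram_congruence[OF sym this, where A = A]
    show "sym_gram (\<lambda>i j. \<Sum>a\<le>d. \<Sum>b\<le>d. A i a * A j b * G a b) d a b =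
        (\<Sum>c\<in>set l. ?S a c * (\<Sum>e\<in>set l. ?g c e * ?S b e))"
      using l(2) by (simp only: sum_distrib_left ac_simps)
  qed
  also have "\<dots> = det (gram_matrix ?S l) * (det (gram_matrix ?g l) * det (gram_matrix (\<lambda>e b. ?S b e) l))"
    using det_gram_mult[OF l(1), of ?S "\<lambda>c b. \<Sum>e\<in>set l. ?g c e * ?S b e"]
      det_gram_mult[OF l(1), of ?g "\<lambda>e b. ?S b e"] by simp
  also have "det (gram_matrix (\<lambda>e b. ?S b e) l) = det (gram_matrix ?S l)"
    by (rule det_gram_transpose)
  also have "det (gram_matrix ?S l) = (\<Prod>a\<in>set l. ?S a a)"
    by (rule det_gram_triangular[OF l(1), where key = "\<lambda>a. sum_list (index_word d a)"])
      (use sym_power_lower_triangular[OF tri] l(2) in auto)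
  also have "(\<Prod>a\<in>set l. ?S a a) = (\<Prod>a\<in>set l. \<Prod>i\<le>d. A i i ^ Poly_Mapping.lookup a i)"
    using l(2) by (intro prod.cong refl sym_power_diagonal[OF tri]) auto
  also have "\<dots> = (\<Prod>i\<le>d. A i i ^ ?N)"
    unfolding l(2)
    by (subst prod.swap, rule prod.cong) (simp_all only: power_sum[symmetric] sum_lookup_multi_indices atMost_iff)
  also have "\<dots> = (\<Prod>i\<le>d. A i i) ^ ?N"
    by (rule prod_power_distrib[symmetric])
  finally show ?thesis by (simp add: mult_2 power_add ac_simps)
qed

section \<open>Orthogonalization without division, and cancellation of minors\<close>

definition leading_block :: "(nat \<Rightarrow> nat \<Rightarrow> 'k) \<Rightarrow> nat \<Rightarrow> 'k mat" where
  "leading_block G n = mat n n (\<lambda>(i, j). G i j)"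

lemma leading_block_carrier [simp]: "leading_block G n \<in> carrier_mat n n"
  by (simp add: leading_block_def)

lemma leading_block_gram: "leading_block G n = gram_matrix G [0..<n]"
  by (intro eq_matI) (auto simp: leading_block_def)

text \<open>
  Fraction-free Gram--Schmidt: row \<open>i\<close> is the last row of the adjugate of the leading block of
  size \<open>i + 1\<close>, hence orthogonal to the first \<open>i\<close> basis vectors.
\<close>

definition orthogonalizer :: "(nat \<Rightarrow> nat \<Rightarrow> 'k::comm_ring_1) \<Rightarrow> nat \<Rightarrow> nat \<Rightarrow> 'k" where
  "orthogonalizer G i j = (if j \<le> i then adj_mat (leading_block G (Suc i)) $$ (i, j) else 0)"

lemma orthogonalizer_diagonal: "orthogonalizer G i i = det (leading_block G i)"
proof -
  have "mat_delete (leading_block G (Suc i)) i i = leading_block G i"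
    by (intro eq_matI) (auto simp: mat_delete_def leading_block_def)
  then show ?thesis
    by (simp add: orthogonalizer_def adj_mat_def cofactor_def leading_block_def)
qed

lemma orthogonalizer_row:
  assumes "j \<le> i"
  shows "(\<Sum>a\<le>i. orthogonalizer G i a * G a j) = (if i = j then det (leading_block G (Suc i)) else 0)"
proof -
  let ?M = "leading_block G (Suc i)"
  have "(adj_mat ?M * ?M) $$ (i, j) = (\<Sum>a<Suc i. adj_mat ?M $$ (i, a) * ?M $$ (a, j))"
    using assms adj_mat(1)[of ?M "Suc i"]
    by (subst index_mult_mat) (auto simp: scalar_prod_def lessThan_atLeast0 leading_block_def)
  also have "\<dots> = (\<Sum>a\<le>i. orthogonalizer G i a * G a j)"
    unfolding lessThan_Suc_atMost
    by (intro sum.cong) (use assms in \<open>auto simp: orthogonalizer_def leading_block_def\<close>)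
  finally show ?thesis
    using assms adj_mat(3)[of ?M "Suc i"] by auto
qed

text \<open>For \<open>j < i\<close>, row \<open>j\<close> involves only basis vectors to which row
  \<open>i\<close> is orthogonal. For \<open>i = j\<close> only the last vector contributes.\<close>

lemma orthogonalizer_congruence:
  fixes G :: "nat \<Rightarrow> nat \<Rightarrow> 'k::comm_ring_1"
  assumes sym: "\<And>a b. a \<le> d \<Longrightarrow> b \<le> d \<Longrightarrow> G a b = G b a"
    and "i \<le> d" "j \<le> d"
  shows "(\<Sum>a\<le>d. \<Sum>b\<le>d. orthogonalizer G i a * orthogonalizer G j b * G a b) =
    (if i = j then det (leading_block G i) * det (leading_block G (Suc i)) else 0)"
proof -
  let ?A = "orthogonalizer G"
  let ?T = "\<lambda>i j. \<Sum>a\<le>d. \<Sum>b\<le>d. ?A i a * ?A j b * G a b"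
  have main: "?T i j = (if i = j then det (leading_block G i) * det (leading_block G (Suc i)) else 0)"
    if "j \<le> i" "i \<le> d" for i j
  proof -
    have cut: "(\<Sum>a\<le>d. ?A i a * f a) = (\<Sum>a\<le>i. ?A i a * f a)" if "i \<le> d" for i f
      using that by (intro sum.mono_neutral_right) (auto simp: orthogonalizer_def)
    have "?T i j = (\<Sum>b\<le>d. ?A j b * (\<Sum>a\<le>d. ?A i a * G a b))"
      by (subst sum.swap) (simp add: sum_distrib_left ac_simps)
    also have "\<dots> = (\<Sum>b\<le>j. ?A j b * (\<Sum>a\<le>i. ?A i a * G a b))"
      using that by (simp add: cut)
    also have "\<dots> = (\<Sum>b\<le>j. if b = i then ?A j i * det (leading_block G (Suc i)) else 0)"
      using that by (intro sum.cong) (auto simp: orthogonalizer_row)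
    finally show ?thesis
      using that by (auto simp: orthogonalizer_diagonal)
  qed
  show ?thesis
  proof (cases "j \<le> i")
    case True
    then show ?thesis using main assms(2) by simp
  next
    case False
    have "?T i j = ?T j i"
      by (subst sum.swap) (auto intro!: sum.cong simp: sym mult.commute)
    then show ?thesis using False main[of i j] assms(3) by simp
  qed
qed

text \<open>The orthogonalizer has the minors on its diagonal, and the diagonalized form has
  products of consecutive minors. Both sides thus carry the same power of the minors, which cannot
  be cancelled in general.\<close>

lemma det_sym_gram_minors:
  fixes G :: "nat \<Rightarrow> nat \<Rightarrow> 'k::comm_ring_1"
  assumes l: "distinct l" "set l = multi_indices d k"
    and sym: "\<And>a b. a \<le> d \<Longrightarrow> b \<le> d \<Longrightarrow> G a b = G b a"
  shows "(\<Prod>i\<le>d. det (leading_block G i)) ^ (2 * ((d + k) choose (d + 1))) *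
      det (gram_matrix (sym_gram G d) l) =
    (\<Prod>i\<le>d. det (leading_block G i)) ^ (2 * ((d + k) choose (d + 1))) *
      (det (leading_block G (Suc d)) ^ ((d + k) choose (d + 1)) * of_int (theta d k))"
proof -
  let ?A = "orthogonalizer G" and ?m = "\<lambda>i. det (leading_block G i)"
  let ?N = "(d + k) choose (d + 1)"
  let ?D = "\<lambda>i. ?m i * ?m (Suc i)"
  have "(\<Prod>i\<le>d. ?m i) ^ (2 * ?N) * det (gram_matrix (sym_gram G d) l) =
      det (gram_matrix (sym_gram (\<lambda>i j. \<Sum>a\<le>d. \<Sum>b\<le>d. ?A i a * ?A j b * G a b) d) l)"
    by (subst det_sym_gram_congruence[OF l sym])
      (auto simp: orthogonalizer_diagonal orthogonalizer_def)
  also have "\<dots> = det (gram_matrix (sym_gram (\<lambda>i j. if i = j then ?D i else 0) d) l)"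
  proof (intro arg_cong[of _ _ det] gram_matrix_cong)
    fix a b assume "a \<in> set l" "b \<in> set l"
    then have "set (index_word d a @ index_word d b) \<subseteq> {..d}"
      using l(2) index_word_in_words by (auto simp: words_def)
    then show "sym_gram (\<lambda>i j. \<Sum>a\<le>d. \<Sum>b\<le>d. ?A i a * ?A j b * G a b) d a b =
        sym_gram (\<lambda>i j. if i = j then ?D i else 0) d a b"
      unfolding sym_gram_def
      by (intro pairing_sum_cong orthogonalizer_congruence sym) auto
  qed
  also have "\<dots> = (\<Prod>i\<le>d. ?D i) ^ ?N * of_int (theta d k)"
    by (rule det_sym_gram_diagonal[OF l])
  also have "(\<Prod>i\<le>d. ?D i) = (\<Prod>i\<le>d. ?m i) ^ 2 * ?m (Suc d)"
  proof -
    \<comment> \<open>The shift of the index loses only the empty minor, which is 1.\<close>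
    have "(\<Prod>i\<le>d. ?m (Suc i)) = (\<Prod>i\<le>d. ?m i) * ?m (Suc d)"
      by (induction d) (simp_all add: leading_block_def ac_simps)
    then show ?thesis by (simp add: prod.distrib power2_eq_square mult.assoc)
  qed
  finally show ?thesis by (simp add: power_mult_distrib power_mult mult.assoc)
qed

lemma monic_cancel:
  fixes p q :: "'k::comm_ring_1 poly"
  assumes "coeff p (degree p) = 1" "p * q = 0"
  shows "q = 0"
  using coeff_mult_degree_sum[of p q] assms by (simp add: leading_coeff_0_iff)

lemma prod_cancel:
  fixes f :: "'a \<Rightarrow> 'k::comm_ring_1"
  assumes "\<And>a q. a \<in> S \<Longrightarrow> f a * q = 0 \<Longrightarrow> q = 0" "prod f S * q = 0"
  shows "q = 0"
  using assms by (induction S rule: infinite_finite_induct) (auto simp: mult.assoc)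

text \<open>
  Over \<open>K[s]\<close> the leading minors of \<open>s I + G\<close> are monic, so they can be cancelled; then put \<open>s = 0\<close>.
\<close>

lemma det_sym_gram:
  fixes G :: "nat \<Rightarrow> nat \<Rightarrow> 'k::comm_ring_1"
  assumes l: "distinct l" "set l = multi_indices d k"
    and sym: "\<And>a b. a \<le> d \<Longrightarrow> b \<le> d \<Longrightarrow> G a b = G b a"
  shows "det (gram_matrix (sym_gram G d) l) =
    det (leading_block G (Suc d)) ^ ((d + k) choose (d + 1)) * of_int (theta d k)"
proof -
  define H :: "nat \<Rightarrow> nat \<Rightarrow> 'k poly" where
    "H i j = (if i = j then [:0, 1:] else 0) + [:G i j:]" for i j
  let ?N = "(d + k) choose (d + 1)"
  let ?p = "\<Prod>i\<le>d. det (leading_block H i)"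
  have monic: "coeff (det (leading_block H n)) (degree (det (leading_block H n))) = 1" for n
  proof -
    \<comment> \<open>The sign is chosen so that \<open>s I - C\<close> is the leading block of
      \<open>s I + G\<close>; its determinant is then a characteristic polynomial, hence
      monic.\<close>
    let ?C = "mat n n (\<lambda>(i, j). - G i j)"
    have "leading_block H n = char_poly_matrix ?C"
      by (intro eq_matI) (auto simp: leading_block_def char_poly_matrix_def H_def)
    then show ?thesis
      using degree_monic_char_poly[of ?C n] by (simp add: char_poly_def)
  qed
  have cancel: "q = 0" if "?p * q = 0" for q
    using that by (rule prod_cancel[rotated]) (use monic monic_cancel in blast)
  have cancel_pow: "q = 0" if "?p ^ n * q = 0" for n q
    using that
  proof (induction n)
    case (Suc n)
    then show ?case using cancel[of "?p ^ n * q"] by (simp add: mult.assoc)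
  qed simp
  have "?p ^ (2 * ?N) * (det (gram_matrix (sym_gram H d) l) -
      det (leading_block H (Suc d)) ^ ?N * of_int (theta d k)) = 0"
    using det_sym_gram_minors[OF l, of H] sym
    by (simp add: right_diff_distrib H_def)
  from cancel_pow[OF this] have eq: "det (gram_matrix (sym_gram H d) l) =
      det (leading_block H (Suc d)) ^ ?N * of_int (theta d k)" by simp
  have H0: "poly (H i j) 0 = G i j" for i j by (simp add: H_def)
  have "det (gram_matrix (sym_gram G d) l) = poly (det (gram_matrix (sym_gram H d) l)) 0"
    by (simp add: poly_hom.hom_det_gram poly_hom.hom_sym_gram H0)
  also have "\<dots> = poly (det (leading_block H (Suc d))) 0 ^ ?N * of_int (theta d k)"
    unfolding eq by (simp add: poly_of_int)
  also have "poly (det (leading_block H (Suc d))) 0 = det (leading_block G (Suc d))"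
    by (simp only: leading_block_gram poly_hom.hom_det_gram H0)
  finally show ?thesis .
qed

theorem theorem3p6:
  fixes d k :: nat
    and scale :: "'k::comm_ring_1 \<Rightarrow> 'v::ab_group_add \<Rightarrow> 'v"
    and V :: "'v set"
    and x :: "nat \<Rightarrow> 'v"
    and B :: "'v \<Rightarrow> 'v \<Rightarrow> 'k"
    and \<alpha>s :: "(nat \<Rightarrow>\<^sub>0 nat) list"
  assumes "Modules.module scale"
    and "inj_on x {..d}"
    and "\<not> Modules.module.dependent scale (x ` {..d})"
    and "V = Modules.module.span scale (x ` {..d})"
    and "symmetric_bilinear_form_on scale V B"
    and "distinct \<alpha>s"
    and "set \<alpha>s = multi_indices d k"
  shows "det (gram_matrix (induced_form B x d k) (map monomial \<alpha>s)) =
         det (gram_matrix B (map x [0..<d + 1])) ^ ((d + k) choose (d + 1)) * of_int (theta d k)"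
proof -
  let ?G = "\<lambda>i j. B (x i) (x j)"
  have "x i \<in> V" if "i \<le> d" for i
    using that assms(4) Modules.module.span_superset[OF assms(1), of "x ` {..d}"] by auto
  then have sym: "?G i j = ?G j i" if "i \<le> d" "j \<le> d" for i j
    using that assms(5) by (auto simp: symmetric_bilinear_form_on_def)
  have "gram_matrix (induced_form B x d k) (map monomial \<alpha>s) = gram_matrix (sym_gram ?G d) \<alpha>s"
    unfolding gram_matrix_map
    by (rule gram_matrix_cong)
      (simp add: induced_form_monomial assms(7) sym_gram_def pairing_sum_map del: map_append)
  moreover have "gram_matrix B (map x [0..<d + 1]) = leading_block ?G (Suc d)"
    by (intro eq_matI) (auto simp: leading_block_def simp del: upt_Suc)
  ultimately show ?thesis
    using det_sym_gram[OF assms(6,7), of ?G, OF sym] by simp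
qed

end
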